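(* Let $N\ge1$, $0<s<1$, $1<p<\infty$ with $s\,p>N$, and let $x_0,y_0\in\mathbb{R}^N$ be two distinct points. For $u:\mathbb{R}^N\to\mathbb{R}$ the following are equivalent: (i) $u\in\mathcal{W}^{s,p}(\mathbb{R}^N)$ is an extremal for $\mathfrak{m}_{s,p}(\mathbb{R}^N)$ and $[u]_{C^{0,\alpha_{s,p}}(\mathbb{R}^N)}=\frac{|u(x_0)-u(y_0)|}{|x_0-y_0|^{\alpha_{s,p}}}$; (ii) $u\in \mathcal{W}^{s,p}(\mathbb{R}^N)$ weakly solves $(-\Delta_p)^s u=c\,(\delta_{x_0}-\delta_{y_0})$ in $\mathbb{R}^N$ for some constant $c\neq0$, i.e. \[ \iint_{\mathbb{R}^N\times\mathbb{R}^N} \frac{J_p(u(x)-u(y))\,(\varphi(x)-\varphi(y))}{|x-y|^{N+s\,p}}\,dx\,dy=c\,(\varphi(x_0)-\varphi(y_0))\quad\text{for every }\varphi\in\mathcal{W}^{s,p}(\mathbb{R}^N); \] (iii) $u\in\mathcal{W}^{s,p}(\mathbb{R}^N)$ is non-constant and is the unique minimizer of \[ \inf_{\varphi\in \mathcal{W}^{s,p}(\mathbb{R}^N)}\Big\{[\varphi]^p_{W^{s,p}(\mathbb{R}^N)}\, :\, \varphi(x_0)=u(x_0)\, \mbox{ and } \varphi(y_0)=u(y_0)\Big\}. \]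
   Context: $J_p(t)=|t|^{p-2}t$. $[\varphi]_{W^{s,p}(\mathbb{R}^N)}=\left(\iint_{\mathbb{R}^N\times\mathbb{R}^N}\frac{|\varphi(x)-\varphi(y)|^p}{|x-y|^{N+s\,p}}dx\,dy\right)^{1/p}$; $[\varphi]_{C^{0,\alpha}(\mathbb{R}^N)}=\sup_{x\ne y}\frac{|\varphi(x)-\varphi(y)|}{|x-y|^\alpha}$; $\alpha_{s,p}=s-N/p$. $\mathcal{W}^{s,p}(\mathbb{R}^N)$ is the set of continuous functions with finite $[\cdot]_{C^{0,\alpha_{s,p}}(\mathbb{R}^N)}$ and finite $[\cdot]_{W^{s,p}(\mathbb{R}^N)}$. $\mathfrak{m}_{s,p}(\mathbb{R}^N)=\inf\{[\varphi]^p_{W^{s,p}(\mathbb{R}^N)}:\varphi\in C^\infty_0(\mathbb{R}^N),\ [\varphi]_{C^{0,\alpha_{s,p}}(\mathbb{R}^N)}=1\}$. An extremal is a non-constant $u\in\mathcal{W}^{s,p}(\mathbb{R}^N)$ with $[u]^p_{W^{s,p}(\mathbb{R}^N)}=\mathfrak{m}_{s,p}(\mathbb{R}^N)[u]^p_{C^{0,\alpha_{s,p}}(\mathbb{R}^N)}$. *)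

theory Defs
  imports "HOL-Analysis.Analysis"
begin

text \<open>Setting: \<open>\<real>^N\<close> is rendered as an arbitrary Euclidean space \<open>'a\<close>, with \<open>N = DIM('a)\<close>.\<close>

definition Jp :: "real \<Rightarrow> real \<Rightarrow> real" where
  "Jp p t = \<bar>t\<bar> powr (p - 2) * t"

definition alpha_sp :: "real \<Rightarrow> real \<Rightarrow> nat \<Rightarrow> real" where
  "alpha_sp s p N = s - real N / p"

definition gagliardo_enn :: "real \<Rightarrow> real \<Rightarrow> ('a::euclidean_space \<Rightarrow> real) \<Rightarrow> ennreal" where
  "gagliardo_enn s p \<phi> =
     (\<integral>\<^sup>+ z. ennreal (\<bar>\<phi> (fst z) - \<phi> (snd z)\<bar> powr p
        / norm (fst z - snd z) powr (real DIM('a) + s * p)) \<partial>(lborel \<Otimes>\<^sub>M lborel))"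

text \<open>\<open>[\<phi>]^p_{W^{s,p}}\<close> (meaningful when finite).\<close>
definition gagliardo_p :: "real \<Rightarrow> real \<Rightarrow> ('a::euclidean_space \<Rightarrow> real) \<Rightarrow> real" where
  "gagliardo_p s p \<phi> = enn2real (gagliardo_enn s p \<phi>)"

definition holder_bounded :: "real \<Rightarrow> ('a::euclidean_space \<Rightarrow> real) \<Rightarrow> bool" where
  "holder_bounded \<alpha> \<phi> \<longleftrightarrow> (\<exists>C. \<forall>x y. x \<noteq> y \<longrightarrow> \<bar>\<phi> x - \<phi> y\<bar> / norm (x - y) powr \<alpha> \<le> C)"

text \<open>\<open>[\<phi>]_{C^{0,\<alpha>}}\<close> (meaningful when \<open>holder_bounded \<alpha> \<phi>\<close>).\<close>
definition holder_sn :: "real \<Rightarrow> ('a::euclidean_space \<Rightarrow> real) \<Rightarrow> real" where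
  "holder_sn \<alpha> \<phi> = (SUP z\<in>{z. fst z \<noteq> snd z}.
      \<bar>\<phi> (fst z) - \<phi> (snd z)\<bar> / norm (fst z - snd z) powr \<alpha>)"

definition Wsp :: "real \<Rightarrow> real \<Rightarrow> ('a::euclidean_space \<Rightarrow> real) set" where
  "Wsp s p = {\<phi>. continuous_on UNIV \<phi>
                  \<and> holder_bounded (alpha_sp s p DIM('a)) \<phi>
                  \<and> gagliardo_enn s p \<phi> < \<infinity>}"

definition partial_deriv :: "'a::euclidean_space \<Rightarrow> ('a \<Rightarrow> real) \<Rightarrow> 'a \<Rightarrow> real" where
  "partial_deriv v f x = deriv (\<lambda>t. f (x + t *\<^sub>R v)) 0"

definition smooth_fun :: "('a::euclidean_space \<Rightarrow> real) \<Rightarrow> bool" where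
  "smooth_fun f \<longleftrightarrow> (\<forall>vs. set vs \<subseteq> Basis \<longrightarrow>
      continuous_on UNIV (foldr partial_deriv vs f) \<and>
      (\<forall>v\<in>Basis. \<forall>x. (\<lambda>t. foldr partial_deriv vs f (x + t *\<^sub>R v)) differentiable (at 0)))"

definition test_fun :: "('a::euclidean_space \<Rightarrow> real) \<Rightarrow> bool" where
  "test_fun f \<longleftrightarrow> smooth_fun f \<and> compact (closure {x. f x \<noteq> 0})"

definition m_sp :: "real \<Rightarrow> real \<Rightarrow> 'a::euclidean_space itself \<Rightarrow> real" where
  "m_sp s p _ = Inf {gagliardo_p s p \<phi> | \<phi> :: 'a \<Rightarrow> real.
      test_fun \<phi> \<and> holder_sn (alpha_sp s p DIM('a)) \<phi> = 1}"

definition extremal :: "real \<Rightarrow> real \<Rightarrow> ('a::euclidean_space \<Rightarrow> real) \<Rightarrow> bool" where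
  "extremal s p u \<longleftrightarrow> u \<in> Wsp s p \<and> (\<exists>x y. u x \<noteq> u y) \<and>
     gagliardo_p s p u = m_sp s p TYPE('a) * holder_sn (alpha_sp s p DIM('a)) u powr p"

definition weak_dipole_solution ::
  "real \<Rightarrow> real \<Rightarrow> ('a::euclidean_space \<Rightarrow> real) \<Rightarrow> real \<Rightarrow> 'a \<Rightarrow> 'a \<Rightarrow> bool" where
  "weak_dipole_solution s p u c x0 y0 \<longleftrightarrow> (\<forall>\<phi>\<in>Wsp s p.
     (\<integral>z. Jp p (u (fst z) - u (snd z)) * (\<phi> (fst z) - \<phi> (snd z))
          / norm (fst z - snd z) powr (real DIM('a) + s * p) \<partial>(lborel \<Otimes>\<^sub>M lborel))
     = c * (\<phi> x0 - \<phi> y0))"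

end

theory Submission
  imports Defs
begin

text \<open>
  Write \<open>E\<close> for the energy \<open>[\<cdot>]\<^sup>p\<close>, \<open>\<alpha> = s - N/p\<close> and \<open>m\<close> for the Morrey constant. All three
  statements are equivalent to: \<open>u x0 \<noteq> u y0\<close>, and \<open>u\<close> minimizes \<open>E\<close> among the functions with the
  same values at \<open>x0\<close> and \<open>y0\<close>. For the dipole equation this is convexity: \<open>E\<close> is the \<open>p\<close>-th power
  of an \<open>L\<^sup>p\<close> norm of the increments \<open>u x - u y\<close>, and the equation says that the derivative of \<open>E\<close>
  at \<open>u\<close> annihilates all functions vanishing at both points. Strict convexity makes the minimizer
  unique.

  By density, the inequality \<open>m \<bar>f x - f y\<bar>\<^sup>p \<le> \<bar>x - y\<bar>^(\<alpha> p) E f\<close> passes from test functions to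
  every \<open>f\<close>: since \<open>s p > N\<close>, the energy of a dilated cut-off tends to zero, so a bounded function
  can be cut off at arbitrarily small cost, and mollification does not increase \<open>E\<close>. Hence an
  extremal whose Hoelder quotient is attained at \<open>(x0, y0)\<close> is a two-point minimizer. Conversely,
  \<open>E\<close> scales by \<open>r^(s p - N)\<close> under precomposition with a similarity of ratio \<open>r\<close>, and the
  similarities act transitively on pairs of distinct points. So the energy of a two-point minimizer
  bounds the quotient of every function at every pair, which identifies the Hoelder seminorm of \<open>u\<close>
  and shows that \<open>u\<close> attains \<open>m\<close>.
\<close>

section \<open>The power function and its derivative\<close>

lemma Jp_eq_max:
  assumes "1 < p"
  shows "Jp p t = max t 0 powr (p - 1) - max (- t) 0 powr (p - 1)"
proof -
  have "\<bar>t\<bar> powr (p - 2) * \<bar>t\<bar> = \<bar>t\<bar> powr (p - 1)"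
    using powr_add[of "\<bar>t\<bar>" "p - 2" 1] by (cases "t = 0") simp_all
  then show ?thesis
    using assms by (cases t "0::real" rule: linorder_cases) (simp_all add: Jp_def)
qed

lemma continuous_on_Jp:
  assumes "1 < p"
  shows "continuous_on UNIV (Jp p)"
proof -
  have "continuous_on UNIV (\<lambda>t. max t 0 powr (p - 1) - max (- t) 0 powr (p - 1))"
    using assms by (intro continuous_intros continuous_on_powr') auto
  then show ?thesis
    by (simp add: Jp_eq_max[OF assms] cong: continuous_on_cong)
qed

lemma borel_measurable_Jp:
  assumes "1 < p"
  shows "Jp p \<in> borel_measurable borel"
  using continuous_on_Jp[OF assms] by (rule borel_measurable_continuous_onI)

lemma Jp_zero [simp]: "Jp p 0 = 0"
  by (simp add: Jp_def)

lemma abs_Jp: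
  assumes "1 < p"
  shows "\<bar>Jp p t\<bar> = \<bar>t\<bar> powr (p - 1)"
  using assms by (auto simp: Jp_eq_max max_def)

lemma Jp_mult_self:
  assumes "0 < p"
  shows "Jp p t * t = \<bar>t\<bar> powr p"
proof (cases "t = 0")
  case False
  have "\<bar>t\<bar> powr p = \<bar>t\<bar> powr (p - 2) * \<bar>t\<bar> powr 2"
    using powr_add[of "\<bar>t\<bar>" "p - 2" 2] by simp
  then show ?thesis
    using False by (simp add: Jp_def power2_eq_square)
qed (use assms in simp)

lemma strict_mono_Jp:
  assumes "1 < p"
  shows "strict_mono (Jp p)"
proof (rule strict_monoI)
  fix x y :: real
  assume "x < y"
  have mono: "a powr (p - 1) \<le> b powr (p - 1)" if "0 \<le> a" "a \<le> b" for a b :: real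
    using that assms by (intro powr_mono2) auto
  have strict: "a powr (p - 1) < b powr (p - 1)" if "0 \<le> a" "a < b" for a b :: real
    using that assms by (intro powr_less_mono2) auto
  have le: "max x 0 powr (p - 1) \<le> max y 0 powr (p - 1)"
    "max (- y) 0 powr (p - 1) \<le> max (- x) 0 powr (p - 1)"
    using \<open>x < y\<close> by (auto intro!: mono)
  show "Jp p x < Jp p y"
  proof (cases "0 < y")
    case True
    then have "max x 0 powr (p - 1) < max y 0 powr (p - 1)"
      using \<open>x < y\<close> by (intro strict) auto
    then show ?thesis
      using le(2) by (simp add: Jp_eq_max[OF assms])
  next
    case False
    then have "max (- y) 0 powr (p - 1) < max (- x) 0 powr (p - 1)"
      using \<open>x < y\<close> by (intro strict) auto
    then show ?thesis
      using le(1) by (simp add: Jp_eq_max[OF assms])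
  qed
qed

lemma has_real_derivative_abs_powr:
  assumes "1 < p"
  shows "((\<lambda>t. \<bar>t\<bar> powr p) has_real_derivative p * Jp p t) (at t)"
proof (cases t "0::real" rule: linorder_cases)
  case less
  have "((\<lambda>t. (- t) powr p) has_real_derivative p * Jp p t) (at t)"
    using less assms by (auto intro!: derivative_eq_intros simp: Jp_eq_max max_def powr_diff)
  then show ?thesis
    by (rule DERIV_cong_ev[THEN iffD1, rotated -1])
      (use less eventually_nhds_in_open[of "{..<0}" t] in \<open>auto elim!: eventually_mono\<close>)
next
  case greater
  have "((\<lambda>t. t powr p) has_real_derivative p * Jp p t) (at t)"
    using greater assms by (auto intro!: derivative_eq_intros simp: Jp_eq_max max_def powr_diff)
  then show ?thesis
    by (rule DERIV_cong_ev[THEN iffD1, rotated -1])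
      (use greater eventually_nhds_in_open[of "{0<..}" t] in \<open>auto elim!: eventually_mono\<close>)
next
  case equal
  have "isCont (Jp p) 0"
    using continuous_on_Jp[OF assms] by (simp add: continuous_on_eq_continuous_at)
  then have "(Jp p \<longlongrightarrow> 0) (at 0)"
    by (simp add: isCont_def)
  then have "((\<lambda>h. \<bar>h\<bar> powr p / h) \<longlongrightarrow> 0) (at 0)"
    by (rule Lim_transform_eventually)
      (use assms in \<open>auto simp: eventually_at_filter simp flip: Jp_mult_self\<close>)
  then show ?thesis
    using assms equal by (simp add: DERIV_def)
qed

lemma has_real_derivative_abs_powr_line:
  assumes "1 < p"
  shows "((\<lambda>t. \<bar>a + t * b\<bar> powr p) has_real_derivative p * Jp p a * b) (at 0)"
  by (rule DERIV_chain2[of "\<lambda>t. \<bar>t\<bar> powr p"])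
    (auto intro!: derivative_eq_intros simp: has_real_derivative_abs_powr[OF assms])

lemma abs_powr_strict_subgradient:
  assumes "1 < p" "a \<noteq> b"
  shows "\<bar>b\<bar> powr p + p * Jp p b * (a - b) < \<bar>a\<bar> powr p"
proof -
  note deriv = has_real_derivative_abs_powr[OF assms(1)]
  have "\<exists>z. \<bar>a\<bar> powr p - \<bar>b\<bar> powr p = (a - b) * (p * Jp p z) \<and> 0 < (a - b) * (Jp p z - Jp p b)"
  proof (cases "b < a")
    case True
    then obtain z where "b < z" "\<bar>a\<bar> powr p - \<bar>b\<bar> powr p = (a - b) * (p * Jp p z)"
      using MVT2[of b a "\<lambda>t. \<bar>t\<bar> powr p" "\<lambda>t. p * Jp p t"] deriv by blast
    then show ?thesis
      using True strict_mono_Jp[OF assms(1)] by (auto simp: strict_mono_def)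
  next
    case False
    then have "a < b"
      using assms(2) by simp
    then obtain z where "z < b" "\<bar>b\<bar> powr p - \<bar>a\<bar> powr p = (b - a) * (p * Jp p z)"
      using MVT2[of a b "\<lambda>t. \<bar>t\<bar> powr p" "\<lambda>t. p * Jp p t"] deriv by blast
    moreover have "0 < (a - b) * (Jp p z - Jp p b)"
      using \<open>a < b\<close> \<open>z < b\<close> strict_mono_Jp[OF assms(1)]
      by (intro mult_neg_neg) (auto simp: strict_mono_def)
    ultimately show ?thesis
      by (intro exI[of _ z]) (simp add: algebra_simps)
  qed
  then obtain z where z: "\<bar>a\<bar> powr p - \<bar>b\<bar> powr p = (a - b) * (p * Jp p z)"
      "0 < (a - b) * (Jp p z - Jp p b)"
    by blast
  have "0 < p * ((a - b) * (Jp p z - Jp p b))"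
    using assms(1) z(2) by simp
  then show ?thesis
    using z(1) by (simp add: algebra_simps)
qed

lemma abs_powr_subgradient:
  assumes "1 < p"
  shows "\<bar>b\<bar> powr p + p * Jp p b * (a - b) \<le> \<bar>a\<bar> powr p"
  using abs_powr_strict_subgradient[OF assms, of a b] by (cases "a = b") auto

lemma max_powr_le_add:
  fixes a b p :: real
  shows "max a b powr p \<le> a powr p + b powr p"
  by (auto simp: max_def)

lemma abs_add_powr_le:
  fixes a b p :: real
  assumes "0 \<le> p"
  shows "\<bar>a + b\<bar> powr p \<le> 2 powr p * (\<bar>a\<bar> powr p + \<bar>b\<bar> powr p)"
proof -
  have "\<bar>a + b\<bar> powr p \<le> (2 * max \<bar>a\<bar> \<bar>b\<bar>) powr p"
    using assms by (intro powr_mono2) auto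
  also have "\<dots> = 2 powr p * max \<bar>a\<bar> \<bar>b\<bar> powr p"
    by (simp add: powr_mult)
  also have "\<dots> \<le> 2 powr p * (\<bar>a\<bar> powr p + \<bar>b\<bar> powr p)"
    by (intro mult_left_mono max_powr_le_add) auto
  finally show ?thesis .
qed

lemma abs_Jp_mult_le:
  assumes "1 < p"
  shows "\<bar>Jp p a * b\<bar> \<le> \<bar>a\<bar> powr p + \<bar>b\<bar> powr p"
proof -
  let ?m = "max \<bar>a\<bar> \<bar>b\<bar>"
  have "\<bar>Jp p a * b\<bar> \<le> ?m powr (p - 1) * ?m powr 1"
    unfolding abs_mult abs_Jp[OF assms] using assms by (intro mult_mono powr_mono2) auto
  also have "\<dots> = ?m powr p"
    by (simp only: flip: powr_add) simp
  also have "\<dots> \<le> \<bar>a\<bar> powr p + \<bar>b\<bar> powr p"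
    by (rule max_powr_le_add)
  finally show ?thesis .
qed

lemma abs_powr_add_diff_le:
  fixes a b p t :: real
  assumes "1 < p" "\<bar>t\<bar> \<le> 1"
  shows "\<bar>\<bar>a + t * b\<bar> powr p - \<bar>a\<bar> powr p\<bar> \<le> p * \<bar>t\<bar> * (2 * 2 powr p * (\<bar>a\<bar> powr p + \<bar>b\<bar> powr p))"
proof -
  let ?C = "2 * 2 powr p * (\<bar>a\<bar> powr p + \<bar>b\<bar> powr p)"
  have "1 \<le> (2::real) powr p"
    using assms(1) by (intro ge_one_powr_ge_zero) auto
  have bound: "\<bar>Jp p c * b\<bar> \<le> ?C" if "\<bar>c\<bar> powr p \<le> 2 powr p * (\<bar>a\<bar> powr p + \<bar>b\<bar> powr p)" for c
  proof -
    have "1 * \<bar>b\<bar> powr p \<le> 2 powr p * (\<bar>a\<bar> powr p + \<bar>b\<bar> powr p)"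
      using \<open>1 \<le> 2 powr p\<close> by (intro mult_mono) auto
    then show ?thesis
      using abs_Jp_mult_le[OF assms(1), of c b] that by linarith
  qed
  have "\<bar>t * b\<bar> powr p \<le> \<bar>b\<bar> powr p"
    using assms mult_right_mono[of "\<bar>t\<bar>" 1 "\<bar>b\<bar>"] by (intro powr_mono2) (auto simp: abs_mult)
  then have "2 powr p * (\<bar>a\<bar> powr p + \<bar>t * b\<bar> powr p) \<le> 2 powr p * (\<bar>a\<bar> powr p + \<bar>b\<bar> powr p)"
    by simp
  then have upper: "\<bar>Jp p (a + t * b) * b\<bar> \<le> ?C"
    using assms(1) abs_add_powr_le[of p a "t * b"] by (intro bound) linarith
  have "1 * \<bar>a\<bar> powr p \<le> 2 powr p * (\<bar>a\<bar> powr p + \<bar>b\<bar> powr p)"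
    using \<open>1 \<le> 2 powr p\<close> by (intro mult_mono) auto
  then have lower: "\<bar>Jp p a * b\<bar> \<le> ?C"
    by (intro bound) simp
  have "p * t * (Jp p a * b) \<le> \<bar>a + t * b\<bar> powr p - \<bar>a\<bar> powr p"
    "\<bar>a + t * b\<bar> powr p - \<bar>a\<bar> powr p \<le> p * t * (Jp p (a + t * b) * b)"
    using abs_powr_subgradient[OF assms(1), of a "a + t * b"]
      abs_powr_subgradient[OF assms(1), of "a + t * b" a] by (simp_all add: algebra_simps)
  moreover have "\<bar>p * t * c\<bar> \<le> p * \<bar>t\<bar> * ?C" if "\<bar>c\<bar> \<le> ?C" for c
    using assms(1) that by (simp add: abs_mult mult_left_mono)
  ultimately show ?thesis
    using upper lower by (smt (verit))
qed

section \<open>Convexity of the \<open>L\<^sup>p\<close> energy\<close>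

definition Lp_space :: "real \<Rightarrow> 'a measure \<Rightarrow> ('a \<Rightarrow> real) set" where
  "Lp_space p M = {U \<in> borel_measurable M. integrable M (\<lambda>x. \<bar>U x\<bar> powr p)}"

lemma Lp_spaceD:
  assumes "U \<in> Lp_space p M"
  shows "U \<in> borel_measurable M" "integrable M (\<lambda>x. \<bar>U x\<bar> powr p)"
  using assms by (auto simp: Lp_space_def)

lemma Lp_space_dominated:
  assumes "0 \<le> p" "F \<in> Lp_space p M" "G \<in> Lp_space p M" and U: "U \<in> borel_measurable M"
    and le: "\<And>x. \<bar>U x\<bar> \<le> \<bar>F x\<bar> + \<bar>G x\<bar>"
  shows "U \<in> Lp_space p M"
proof -
  have "\<bar>U x\<bar> powr p \<le> 2 powr p * (\<bar>F x\<bar> powr p + \<bar>G x\<bar> powr p)" for x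
  proof -
    have "\<bar>U x\<bar> powr p \<le> \<bar>\<bar>F x\<bar> + \<bar>G x\<bar>\<bar> powr p"
      using assms(1) le[of x] by (intro powr_mono2) auto
    then show ?thesis
      using abs_add_powr_le[OF assms(1), of "\<bar>F x\<bar>" "\<bar>G x\<bar>"] by simp
  qed
  moreover have "integrable M (\<lambda>x. 2 powr p * (\<bar>F x\<bar> powr p + \<bar>G x\<bar> powr p))"
    using assms(2,3)
    by (intro integrable_mult_right Bochner_Integration.integrable_add Lp_spaceD)
  ultimately have "integrable M (\<lambda>x. \<bar>U x\<bar> powr p)"
    using U by (elim Bochner_Integration.integrable_bound[where g = "\<lambda>x. \<bar>U x\<bar> powr p"]) auto
  then show ?thesis
    using U by (simp add: Lp_space_def)
qed

lemma Lp_space_cmult: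
  assumes "U \<in> Lp_space p M"
  shows "(\<lambda>x. c * U x) \<in> Lp_space p M"
  using assms by (auto simp: Lp_space_def abs_mult powr_mult)

lemma Lp_space_add:
  assumes "0 \<le> p" "U \<in> Lp_space p M" "F \<in> Lp_space p M"
  shows "(\<lambda>x. U x + F x) \<in> Lp_space p M"
proof (rule Lp_space_dominated[OF assms])
  note [measurable] = assms(2,3)[THEN Lp_spaceD(1)]
  show "(\<lambda>x. U x + F x) \<in> borel_measurable M"
    by measurable
qed (rule abs_triangle_ineq)

lemma integrable_Jp_mult:
  assumes "1 < p" "U \<in> Lp_space p M" "F \<in> Lp_space p M"
  shows "integrable M (\<lambda>x. Jp p (U x) * F x)"
proof (rule Bochner_Integration.integrable_bound)
  show "integrable M (\<lambda>x. \<bar>U x\<bar> powr p + \<bar>F x\<bar> powr p)"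
    using assms by (intro Bochner_Integration.integrable_add Lp_spaceD)
  note [measurable] = borel_measurable_Jp[OF assms(1)] assms(2,3)[THEN Lp_spaceD(1)]
  show "(\<lambda>x. Jp p (U x) * F x) \<in> borel_measurable M"
    by measurable
  show "AE x in M. norm (Jp p (U x) * F x) \<le> norm (\<bar>U x\<bar> powr p + \<bar>F x\<bar> powr p)"
    using abs_Jp_mult_le[OF assms(1)] by auto
qed

lemma integral_abs_powr_subgradient:
  assumes p: "1 < p" and UF: "U \<in> Lp_space p M" "F \<in> Lp_space p M"
  shows "(\<integral>x. \<bar>U x\<bar> powr p \<partial>M) + p * (\<integral>x. Jp p (U x) * (F x - U x) \<partial>M) \<le> (\<integral>x. \<bar>F x\<bar> powr p \<partial>M)"
    (is ?le)
    and "(\<integral>x. \<bar>U x\<bar> powr p \<partial>M) + p * (\<integral>x. Jp p (U x) * (F x - U x) \<partial>M) = (\<integral>x. \<bar>F x\<bar> powr p \<partial>M)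
      \<Longrightarrow> AE x in M. F x = U x"
proof -
  define gap where
    "gap x = \<bar>F x\<bar> powr p - (\<bar>U x\<bar> powr p + p * (Jp p (U x) * (F x - U x)))" for x
  have "(\<lambda>x. F x - U x) \<in> Lp_space p M"
    using Lp_space_add[OF _ UF(2) Lp_space_cmult[OF UF(1), of "-1"]] p by simp
  note integrable = UF[THEN Lp_spaceD(2)] integrable_Jp_mult[OF p UF(1) this]
  have gap_integral: "(\<integral>x. gap x \<partial>M) = (\<integral>x. \<bar>F x\<bar> powr p \<partial>M)
      - ((\<integral>x. \<bar>U x\<bar> powr p \<partial>M) + p * (\<integral>x. Jp p (U x) * (F x - U x) \<partial>M))"
    using integrable by (simp add: gap_def)
  have gap_nonneg: "0 \<le> gap x" for x
    using abs_powr_subgradient[OF p, of "U x" "F x"] by (simp add: gap_def mult.assoc)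
  have "0 \<le> (\<integral>x. gap x \<partial>M)"
    by (intro integral_nonneg_AE AE_I2 gap_nonneg)
  then show ?le
    by (simp add: gap_integral)
  assume "(\<integral>x. \<bar>U x\<bar> powr p \<partial>M) + p * (\<integral>x. Jp p (U x) * (F x - U x) \<partial>M) = (\<integral>x. \<bar>F x\<bar> powr p \<partial>M)"
  then have "(\<integral>x. gap x \<partial>M) = 0"
    by (simp add: gap_integral)
  moreover have "integrable M gap"
    unfolding gap_def using integrable by auto
  ultimately have "AE x in M. gap x = 0"
    using gap_nonneg by (simp add: integral_nonneg_eq_0_iff_AE)
  moreover have "F x = U x" if "gap x = 0" for x
    using that abs_powr_strict_subgradient[OF p, of "F x" "U x"] by (auto simp: gap_def mult.assoc)
  ultimately show "AE x in M. F x = U x"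
    by (rule eventually_mono)
qed

lemma integral_abs_powr_difference_quotient_tendsto:
  assumes p: "1 < p" and UF: "U \<in> Lp_space p M" "F \<in> Lp_space p M"
    and X: "X \<longlonglongrightarrow> 0" "\<And>n. X n \<noteq> 0" "\<And>n. \<bar>X n\<bar> \<le> 1"
  shows "(\<lambda>n. \<integral>x. (\<bar>U x + X n * F x\<bar> powr p - \<bar>U x\<bar> powr p) / X n \<partial>M)
    \<longlonglongrightarrow> (\<integral>x. p * (Jp p (U x) * F x) \<partial>M)"
proof (rule integral_dominated_convergence)
  note [measurable] = UF[THEN Lp_spaceD(1)] borel_measurable_Jp[OF p]
  show "(\<lambda>x. p * (Jp p (U x) * F x)) \<in> borel_measurable M"
    "(\<lambda>x. (\<bar>U x + X n * F x\<bar> powr p - \<bar>U x\<bar> powr p) / X n) \<in> borel_measurable M" for n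
    by measurable
  show "integrable M (\<lambda>x. p * (2 * 2 powr p * (\<bar>U x\<bar> powr p + \<bar>F x\<bar> powr p)))"
    using UF by (intro integrable_mult_right Bochner_Integration.integrable_add Lp_spaceD)
  have "(\<lambda>n. (\<bar>U x + X n * F x\<bar> powr p - \<bar>U x\<bar> powr p) / X n) \<longlonglongrightarrow> p * (Jp p (U x) * F x)" for x
  proof -
    have "((\<lambda>t. (\<bar>U x + t * F x\<bar> powr p - \<bar>U x\<bar> powr p) / t) \<longlongrightarrow> p * Jp p (U x) * F x) (at 0)"
      using has_real_derivative_abs_powr_line[OF p, of "U x" "F x"] by (simp add: DERIV_def)
    then show ?thesis
      using X(1,2) by (auto simp: tendsto_at_iff_sequentially comp_def mult.assoc)
  qed
  then show "AE x in M. (\<lambda>n. (\<bar>U x + X n * F x\<bar> powr p - \<bar>U x\<bar> powr p) / X n)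
      \<longlonglongrightarrow> p * (Jp p (U x) * F x)"
    by simp
  show "AE x in M. norm ((\<bar>U x + X n * F x\<bar> powr p - \<bar>U x\<bar> powr p) / X n)
      \<le> p * (2 * 2 powr p * (\<bar>U x\<bar> powr p + \<bar>F x\<bar> powr p))" for n
    using abs_powr_add_diff_le[OF p X(3)[of n]] X(2)[of n]
    by (simp add: abs_divide pos_divide_le_eq mult_ac)
qed

lemma has_real_derivative_integral_abs_powr:
  assumes p: "1 < p" and UF: "U \<in> Lp_space p M" "F \<in> Lp_space p M"
  shows "((\<lambda>t. \<integral>x. \<bar>U x + t * F x\<bar> powr p \<partial>M) has_real_derivative
    p * (\<integral>x. Jp p (U x) * F x \<partial>M)) (at 0)"
proof -
  define quot where "quot t x = (\<bar>U x + t * F x\<bar> powr p - \<bar>U x\<bar> powr p) / t" for t x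
  have "(\<lambda>x. U x + t * F x) \<in> Lp_space p M" for t
    using p UF by (intro Lp_space_add Lp_space_cmult) auto
  then have "(\<integral>x. quot t x \<partial>M)
      = ((\<integral>x. \<bar>U x + t * F x\<bar> powr p \<partial>M) - (\<integral>x. \<bar>U x\<bar> powr p \<partial>M)) / t" for t
    using UF(1) by (simp add: quot_def Lp_spaceD(2))
  moreover have "(\<lambda>n. \<integral>x. quot (X n) x \<partial>M) \<longlonglongrightarrow> (\<integral>x. p * (Jp p (U x) * F x) \<partial>M)"
    if X: "\<And>n. X n \<noteq> 0" "X \<longlonglongrightarrow> 0" for X
  proof -
    obtain n0 where "\<And>n. n0 \<le> n \<Longrightarrow> \<bar>X n\<bar> \<le> 1"
      using LIMSEQ_D[OF X(2), of 1] by (auto intro: less_imp_le)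
    then have "(\<lambda>n. \<integral>x. quot (X (n + n0)) x \<partial>M) \<longlonglongrightarrow> (\<integral>x. p * (Jp p (U x) * F x) \<partial>M)"
      unfolding quot_def using X
      by (intro integral_abs_powr_difference_quotient_tendsto[OF p UF]
          LIMSEQ_ignore_initial_segment) auto
    then show ?thesis
      by (rule LIMSEQ_offset)
  qed
  ultimately show ?thesis
    by (auto simp: DERIV_def tendsto_at_iff_sequentially comp_def)
qed

text \<open>Jensen's inequality: integrate the subgradient inequality at the mean value.\<close>

lemma abs_powr_integral_le:
  fixes p :: real and f k :: "'a \<Rightarrow> real"
  assumes p: "1 < p"
    and k: "\<And>x. 0 \<le> k x" "integrable M k" "(\<integral>x. k x \<partial>M) = 1"
    and f: "integrable M (\<lambda>x. k x * f x)" "integrable M (\<lambda>x. k x * \<bar>f x\<bar> powr p)"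
  shows "\<bar>\<integral>x. k x * f x \<partial>M\<bar> powr p \<le> (\<integral>x. k x * \<bar>f x\<bar> powr p \<partial>M)"
proof -
  define m where "m = (\<integral>x. k x * f x \<partial>M)"
  have "\<bar>m\<bar> powr p = (\<integral>x. (\<bar>m\<bar> powr p - p * Jp p m * m) * k x + p * Jp p m * (k x * f x) \<partial>M)"
    using k f by (simp add: m_def[symmetric])
  also have "\<dots> \<le> (\<integral>x. k x * \<bar>f x\<bar> powr p \<partial>M)"
  proof (rule integral_mono)
    fix x
    have "k x * (\<bar>m\<bar> powr p + p * Jp p m * (f x - m)) \<le> k x * \<bar>f x\<bar> powr p"
      by (intro mult_left_mono abs_powr_subgradient[OF p] k(1))
    then show "(\<bar>m\<bar> powr p - p * Jp p m * m) * k x + p * Jp p m * (k x * f x) \<le> k x * \<bar>f x\<bar> powr p"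
      by (simp add: algebra_simps)
  qed (use k f in auto)
  finally show ?thesis
    by (simp add: m_def)
qed

section \<open>The Gagliardo energy as an \<open>L\<^sup>p\<close> energy of increments\<close>

definition increment :: "('a \<Rightarrow> real) \<Rightarrow> 'a \<times> 'a \<Rightarrow> real" where
  "increment f z = f (fst z) - f (snd z)"

definition gagliardo_measure :: "real \<Rightarrow> real \<Rightarrow> ('a::euclidean_space \<times> 'a) measure" where
  "gagliardo_measure s p = density (lborel \<Otimes>\<^sub>M lborel)
     (\<lambda>z. ennreal (1 / norm (fst z - snd z) powr (real DIM('a) + s * p)))"

lemma sets_gagliardo_measure [measurable_cong]:
  "sets (gagliardo_measure s p) = sets (lborel \<Otimes>\<^sub>M lborel)"
  by (simp add: gagliardo_measure_def)

lemma increment_measurable [measurable]: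
  fixes f :: "'a::euclidean_space \<Rightarrow> real"
  assumes [measurable]: "f \<in> borel_measurable borel"
  shows "increment f \<in> borel_measurable (lborel \<Otimes>\<^sub>M lborel)"
  unfolding increment_def by measurable

lemma sigma_finite_gagliardo_measure:
  "sigma_finite_measure (gagliardo_measure s p :: ('a::euclidean_space \<times> 'a) measure)"
proof -
  have "sigma_finite_measure (lborel \<Otimes>\<^sub>M lborel :: ('a \<times> 'a) measure)"
    unfolding lborel_prod by (rule sigma_finite_lborel)
  then show ?thesis
    unfolding gagliardo_measure_def
    by (subst sigma_finite_measure.sigma_finite_iff_density_finite) auto
qed

lemma gagliardo_enn_eq_nn_integral:
  fixes f :: "'a::euclidean_space \<Rightarrow> real"
  assumes [measurable]: "f \<in> borel_measurable borel"
  shows "gagliardo_enn s p f = (\<integral>\<^sup>+z. ennreal (\<bar>increment f z\<bar> powr p) \<partial>gagliardo_measure s p)"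
  unfolding gagliardo_enn_def gagliardo_measure_def
  by (simp add: nn_integral_density increment_def flip: ennreal_mult)

lemma gagliardo_enn_eq_iterated:
  fixes f :: "'a::euclidean_space \<Rightarrow> real"
  assumes [measurable]: "f \<in> borel_measurable borel"
  shows "gagliardo_enn s p f = (\<integral>\<^sup>+x. \<integral>\<^sup>+y. ennreal (\<bar>f x - f y\<bar> powr p
    / norm (x - y) powr (real DIM('a) + s * p)) \<partial>lborel \<partial>lborel)"
  unfolding gagliardo_enn_def by (subst lborel.nn_integral_fst[symmetric]) simp_all

lemma gagliardo_p_nonneg [simp]: "0 \<le> gagliardo_p s p f"
  by (simp add: gagliardo_p_def)

lemma gagliardo_enn_affine:
  fixes f :: "'a::euclidean_space \<Rightarrow> real"
  assumes [measurable]: "f \<in> borel_measurable borel"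
  shows "gagliardo_enn s p (\<lambda>x. c * f x + d) = ennreal (\<bar>c\<bar> powr p) * gagliardo_enn s p f"
proof -
  have "increment (\<lambda>x. c * f x + d) z = c * increment f z" for z
    by (simp add: increment_def algebra_simps)
  then show ?thesis
    by (simp add: gagliardo_enn_eq_nn_integral abs_mult powr_mult ennreal_mult nn_integral_cmult)
qed

lemma gagliardo_p_affine:
  assumes "f \<in> borel_measurable borel"
  shows "gagliardo_p s p (\<lambda>x. c * f x + d) = \<bar>c\<bar> powr p * gagliardo_p s p f"
  by (simp add: gagliardo_p_def gagliardo_enn_affine[OF assms] enn2real_mult)

lemma holder_boundedI:
  assumes "\<And>x y. \<bar>f x - f y\<bar> \<le> C * norm (x - y) powr \<alpha>"
  shows "holder_bounded \<alpha> f"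
  unfolding holder_bounded_def using assms by (intro exI[of _ C]) (auto simp: divide_simps)

lemma holder_boundedE:
  assumes "holder_bounded \<alpha> f"
  obtains C where "0 \<le> C" "\<And>x y. \<bar>f x - f y\<bar> \<le> C * norm (x - y) powr \<alpha>"
proof -
  obtain C where C: "\<And>x y. x \<noteq> y \<Longrightarrow> \<bar>f x - f y\<bar> / norm (x - y) powr \<alpha> \<le> C"
    using assms unfolding holder_bounded_def by blast
  have "\<bar>f x - f y\<bar> \<le> max C 0 * norm (x - y) powr \<alpha>" for x y
  proof (cases "x = y")
    case False
    then have "\<bar>f x - f y\<bar> \<le> C * norm (x - y) powr \<alpha>"
      using C[OF False] by (simp add: divide_simps)
    also have "\<dots> \<le> max C 0 * norm (x - y) powr \<alpha>"
      by (intro mult_right_mono) auto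
    finally show ?thesis .
  qed simp
  then show ?thesis
    using that[of "max C 0"] by simp
qed

lemma Wsp_iff:
  fixes f :: "'a::euclidean_space \<Rightarrow> real"
  shows "f \<in> Wsp s p \<longleftrightarrow> continuous_on UNIV f \<and> holder_bounded (alpha_sp s p DIM('a)) f
    \<and> increment f \<in> Lp_space p (gagliardo_measure s p)"
proof (cases "continuous_on UNIV f")
  case True
  then have [measurable]: "f \<in> borel_measurable borel"
    by (rule borel_measurable_continuous_onI)
  then show ?thesis
    by (auto simp: Wsp_def Lp_space_def integrable_iff_bounded gagliardo_enn_eq_nn_integral)
qed (simp add: Wsp_def)

lemma WspD:
  fixes f :: "'a::euclidean_space \<Rightarrow> real"
  assumes "f \<in> Wsp s p"
  shows "continuous_on UNIV f" "f \<in> borel_measurable borel"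
    "holder_bounded (alpha_sp s p DIM('a)) f"
    "increment f \<in> Lp_space p (gagliardo_measure s p)"
  using assms by (auto simp: Wsp_iff borel_measurable_continuous_onI)

lemma gagliardo_enn_eq_ennreal:
  "f \<in> Wsp s p \<Longrightarrow> gagliardo_enn s p f = ennreal (gagliardo_p s p f)"
  by (simp add: gagliardo_p_def Wsp_def)

lemma gagliardo_p_eq_integral:
  assumes "f \<in> Wsp s p"
  shows "gagliardo_p s p f = (\<integral>z. \<bar>increment f z\<bar> powr p \<partial>gagliardo_measure s p)"
proof -
  have [measurable]: "f \<in> borel_measurable borel"
    using assms by (rule WspD)
  show ?thesis
    by (simp add: gagliardo_p_def gagliardo_enn_eq_nn_integral integral_eq_nn_integral)
qed

lemma gagliardo_p_le_add:
  assumes W: "f \<in> Wsp s p" "g \<in> Wsp s p" "h \<in> Wsp s p"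
    and le: "\<And>x y. \<bar>f x - f y\<bar> powr p \<le> \<bar>g x - g y\<bar> powr p + \<bar>h x - h y\<bar> powr p"
  shows "gagliardo_p s p f \<le> gagliardo_p s p g + gagliardo_p s p h"
proof -
  note integrable = W[THEN WspD(4), THEN Lp_spaceD(2)]
  have "(\<integral>z. \<bar>increment f z\<bar> powr p \<partial>gagliardo_measure s p)
      \<le> (\<integral>z. \<bar>increment g z\<bar> powr p + \<bar>increment h z\<bar> powr p \<partial>gagliardo_measure s p)"
    using integrable le by (intro integral_mono) (auto simp: increment_def)
  then show ?thesis
    using integrable by (simp add: W[THEN gagliardo_p_eq_integral])
qed

lemma Wsp_dominated:
  fixes f g h :: "'a::euclidean_space \<Rightarrow> real"
  assumes p: "0 \<le> p" and f: "continuous_on UNIV f" and gh: "g \<in> Wsp s p" "h \<in> Wsp s p"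
    and le: "\<And>x y. \<bar>f x - f y\<bar> \<le> \<bar>g x - g y\<bar> + \<bar>h x - h y\<bar>"
  shows "f \<in> Wsp s p"
proof -
  let ?\<alpha> = "alpha_sp s p DIM('a)"
  obtain C where "0 \<le> C" and C: "\<And>x y. \<bar>g x - g y\<bar> \<le> C * norm (x - y) powr ?\<alpha>"
    using holder_boundedE[OF WspD(3)[OF gh(1)]] by blast
  obtain D where "0 \<le> D" and D: "\<And>x y. \<bar>h x - h y\<bar> \<le> D * norm (x - y) powr ?\<alpha>"
    using holder_boundedE[OF WspD(3)[OF gh(2)]] by blast
  have "holder_bounded ?\<alpha> f"
  proof (rule holder_boundedI)
    show "\<bar>f x - f y\<bar> \<le> (C + D) * norm (x - y) powr ?\<alpha>" for x y
      using le[of x y] C[of x y] D[of x y] by (simp add: distrib_right)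
  qed
  moreover have "increment f \<in> Lp_space p (gagliardo_measure s p)"
  proof (rule Lp_space_dominated[OF p gh[THEN WspD(4)]])
    have [measurable]: "f \<in> borel_measurable borel"
      using f by (rule borel_measurable_continuous_onI)
    show "increment f \<in> borel_measurable (gagliardo_measure s p)"
      by measurable
    show "\<bar>increment f z\<bar> \<le> \<bar>increment g z\<bar> + \<bar>increment h z\<bar>" for z
      using le by (simp add: increment_def)
  qed
  ultimately show ?thesis
    using f by (simp add: Wsp_iff)
qed

lemma Wsp_const: "(\<lambda>_. c) \<in> Wsp s p"
  by (auto simp: Wsp_def gagliardo_enn_def holder_bounded_def)

lemma gagliardo_p_const: "gagliardo_p s p (\<lambda>_. c) = 0"
  by (simp add: gagliardo_p_def gagliardo_enn_def)

lemma Wsp_affine: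
  fixes f :: "'a::euclidean_space \<Rightarrow> real"
  assumes f: "f \<in> Wsp s p"
  shows "(\<lambda>x. c * f x + d) \<in> Wsp s p"
proof -
  let ?\<alpha> = "alpha_sp s p DIM('a)"
  have diff: "(c * f x + d) - (c * f y + d) = c * (f x - f y)" for x y
    by (simp add: algebra_simps)
  obtain C where "0 \<le> C" and C: "\<And>x y. \<bar>f x - f y\<bar> \<le> C * norm (x - y) powr ?\<alpha>"
    using holder_boundedE[OF WspD(3)[OF f]] by blast
  have "holder_bounded ?\<alpha> (\<lambda>x. c * f x + d)"
  proof (rule holder_boundedI)
    show "\<bar>(c * f x + d) - (c * f y + d)\<bar> \<le> (\<bar>c\<bar> * C) * norm (x - y) powr ?\<alpha>" for x y
      unfolding diff using C[of x y] by (simp add: abs_mult mult.assoc mult_left_mono)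
  qed
  moreover have "continuous_on UNIV (\<lambda>x. c * f x + d)"
    using WspD(1)[OF f] by (intro continuous_intros)
  moreover have "increment (\<lambda>x. c * f x + d) = (\<lambda>z. c * increment f z)"
    by (rule ext) (simp only: increment_def diff)
  ultimately show ?thesis
    using Lp_space_cmult[OF WspD(4)[OF f]] by (simp add: Wsp_iff)
qed

lemma Wsp_add:
  assumes "0 \<le> p" "f \<in> Wsp s p" "g \<in> Wsp s p"
  shows "(\<lambda>x. f x + g x) \<in> Wsp s p"
  using assms(2,3)[THEN WspD(1)]
  by (intro Wsp_dominated[OF assms(1) _ assms(2,3)] continuous_on_add) auto

lemma Wsp_add_cmult:
  assumes "0 \<le> p" "f \<in> Wsp s p" "g \<in> Wsp s p"
  shows "(\<lambda>x. f x + c * g x) \<in> Wsp s p"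
  using Wsp_add[OF assms(1,2) Wsp_affine[OF assms(3), of c 0]] by simp

lemma Wsp_diff:
  assumes "0 \<le> p" "f \<in> Wsp s p" "g \<in> Wsp s p"
  shows "(\<lambda>x. f x - g x) \<in> Wsp s p"
  using Wsp_add_cmult[OF assms, of "-1"] by simp

lemma Wsp_min:
  assumes "0 \<le> p" "f \<in> Wsp s p" "g \<in> Wsp s p"
  shows "(\<lambda>x. min (f x) (g x)) \<in> Wsp s p"
  using assms(2,3)[THEN WspD(1)]
  by (intro Wsp_dominated[OF assms(1) _ assms(2,3)] continuous_on_min) auto

lemma gagliardo_p_min_le:
  assumes "0 \<le> p" "f \<in> Wsp s p" "g \<in> Wsp s p"
  shows "gagliardo_p s p (\<lambda>x. min (f x) (g x)) \<le> gagliardo_p s p f + gagliardo_p s p g"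
proof (rule gagliardo_p_le_add[OF Wsp_min[OF assms] assms(2,3)])
  fix x y
  have "\<bar>min (f x) (g x) - min (f y) (g y)\<bar> powr p \<le> max \<bar>f x - f y\<bar> \<bar>g x - g y\<bar> powr p"
    using assms(1) by (intro powr_mono2) auto
  also have "\<dots> \<le> \<bar>f x - f y\<bar> powr p + \<bar>g x - g y\<bar> powr p"
    by (rule max_powr_le_add)
  finally show "\<bar>min (f x) (g x) - min (f y) (g y)\<bar> powr p
      \<le> \<bar>f x - f y\<bar> powr p + \<bar>g x - g y\<bar> powr p" .
qed

lemma
  assumes p: "0 \<le> p" and f: "continuous_on UNIV f" and g: "g \<in> Wsp s p"
    and le: "\<And>x y. \<bar>f x - f y\<bar> \<le> \<bar>g x - g y\<bar>"
  shows Wsp_mono: "f \<in> Wsp s p"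
    and gagliardo_p_mono: "gagliardo_p s p f \<le> gagliardo_p s p g"
proof -
  show W: "f \<in> Wsp s p"
    using le by (intro Wsp_dominated[OF p f g Wsp_const[of 0]]) simp
  show "gagliardo_p s p f \<le> gagliardo_p s p g"
    using gagliardo_p_le_add[OF W g Wsp_const[of 0]] powr_mono2[OF p abs_ge_zero le]
    by (simp add: gagliardo_p_const)
qed

section \<open>The first variation of the energy\<close>

definition gagliardo_form ::
  "real \<Rightarrow> real \<Rightarrow> ('a::euclidean_space \<Rightarrow> real) \<Rightarrow> ('a \<Rightarrow> real) \<Rightarrow> real" where
  "gagliardo_form s p u f = (\<integral>z. Jp p (increment u z) * increment f z \<partial>gagliardo_measure s p)"

lemma weak_dipole_solution_iff:
  fixes u :: "'a::euclidean_space \<Rightarrow> real"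
  assumes "1 < p" "u \<in> Wsp s p"
  shows "weak_dipole_solution s p u c x0 y0
    \<longleftrightarrow> (\<forall>f\<in>Wsp s p. gagliardo_form s p u f = c * (f x0 - f y0))"
proof -
  have "gagliardo_form s p u f = (\<integral>z. Jp p (u (fst z) - u (snd z)) * (f (fst z) - f (snd z))
      / norm (fst z - snd z) powr (real DIM('a) + s * p) \<partial>(lborel \<Otimes>\<^sub>M lborel))"
    if f: "f \<in> Wsp s p" for f :: "'a \<Rightarrow> real"
  proof -
    note [measurable] = borel_measurable_Jp[OF assms(1)] WspD(2)[OF assms(2)] WspD(2)[OF f]
    have "(\<lambda>z. Jp p (increment u z) * increment f z) \<in> borel_measurable (lborel \<Otimes>\<^sub>M lborel)"
      by measurable
    then show ?thesis
      by (simp add: gagliardo_form_def gagliardo_measure_def integral_density increment_def)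
  qed
  then show ?thesis
    by (simp add: weak_dipole_solution_def)
qed

lemma gagliardo_form_add_cmult:
  assumes "1 < p" "u \<in> Wsp s p" "f \<in> Wsp s p" "g \<in> Wsp s p"
  shows "gagliardo_form s p u (\<lambda>x. f x + c * g x)
    = gagliardo_form s p u f + c * gagliardo_form s p u g"
proof -
  have "increment (\<lambda>x. f x + c * g x) z = increment f z + c * increment g z" for z
    by (simp add: increment_def algebra_simps)
  then show ?thesis
    using integrable_Jp_mult[OF assms(1) assms(2,3)[THEN WspD(4)]]
      integrable_Jp_mult[OF assms(1) assms(2,4)[THEN WspD(4)]]
    by (simp add: gagliardo_form_def distrib_left mult.left_commute)
qed

lemma gagliardo_form_const: "gagliardo_form s p u (\<lambda>_. c) = 0"
  by (simp add: gagliardo_form_def increment_def)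

lemma gagliardo_form_self:
  assumes "1 < p" "u \<in> Wsp s p"
  shows "gagliardo_form s p u u = gagliardo_p s p u"
  using assms by (simp add: gagliardo_form_def gagliardo_p_eq_integral Jp_mult_self)

lemma gagliardo_p_subgradient:
  assumes "1 < p" "u \<in> Wsp s p" "f \<in> Wsp s p"
  shows "gagliardo_p s p u + p * gagliardo_form s p u (\<lambda>x. f x - u x) \<le> gagliardo_p s p f"
proof -
  have "increment (\<lambda>x. f x - u x) z = increment f z - increment u z" for z
    by (simp add: increment_def)
  then show ?thesis
    using integral_abs_powr_subgradient(1)[OF assms(1) assms(2,3)[THEN WspD(4)]] assms(2,3)
    by (simp add: gagliardo_form_def gagliardo_p_eq_integral)
qed

lemma AE_lborel_continuous_imp_eq_0:
  fixes h :: "'a::euclidean_space \<Rightarrow> real"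
  assumes "continuous_on UNIV h" "AE x in lborel. h x = 0"
  shows "h x = 0"
proof -
  have "open {x. h x \<noteq> 0}"
    using assms(1) by (intro open_Collect_neq continuous_intros)
  moreover from this have "emeasure lborel {x. h x \<noteq> 0} = 0"
    using assms(2) by (subst (asm) AE_iff_measurable[of "{x. h x \<noteq> 0}"]) auto
  ultimately have "{x. h x \<noteq> 0} = {}"
    using open_not_negligible[of "{x. h x \<noteq> 0}"]
    by (auto simp: negligible_iff_null_sets null_sets_def emeasure_completion)
  then show ?thesis
    by auto
qed

lemma AE_increment_eq_imp_eq:
  fixes f g :: "'a::euclidean_space \<Rightarrow> real"
  assumes "continuous_on UNIV f" "continuous_on UNIV g"
    and "AE z in gagliardo_measure s p. increment f z = increment g z"
  shows "f x - f y = g x - g y"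
proof -
  let ?h = "\<lambda>z. increment f z - increment g z"
  have "AE z in lborel \<Otimes>\<^sub>M lborel. ?h z = 0"
    using assms(3) unfolding gagliardo_measure_def
    by (subst (asm) AE_density) (auto simp: increment_def elim!: eventually_mono)
  then have "AE z in lborel. ?h z = 0"
    unfolding lborel_prod .
  moreover have "continuous_on UNIV ?h"
    unfolding increment_def
    by (intro continuous_on_diff continuous_on_compose2[OF assms(1)]
        continuous_on_compose2[OF assms(2)] continuous_on_fst continuous_on_snd continuous_on_id)
      auto
  ultimately have "?h (x, y) = 0"
    by (intro AE_lborel_continuous_imp_eq_0)
  then show ?thesis
    by (simp add: increment_def)
qed

lemma gagliardo_p_subgradient_eq:
  fixes u f :: "'a::euclidean_space \<Rightarrow> real"
  assumes "1 < p" "u \<in> Wsp s p" "f \<in> Wsp s p"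
    and eq: "gagliardo_p s p u + p * gagliardo_form s p u (\<lambda>x. f x - u x) = gagliardo_p s p f"
  shows "f x - f y = u x - u y"
proof -
  have "increment (\<lambda>x. f x - u x) z = increment f z - increment u z" for z
    by (simp add: increment_def)
  then have "AE z in gagliardo_measure s p. increment f z = increment u z"
    using integral_abs_powr_subgradient(2)[OF assms(1) assms(2,3)[THEN WspD(4)]] eq assms(2,3)
    by (simp add: gagliardo_form_def gagliardo_p_eq_integral)
  then show ?thesis
    by (rule AE_increment_eq_imp_eq[OF assms(3,2)[THEN WspD(1)]])
qed

lemma has_real_derivative_gagliardo_p:
  assumes "1 < p" "u \<in> Wsp s p" "f \<in> Wsp s p"
  shows "((\<lambda>t. gagliardo_p s p (\<lambda>x. u x + t * f x)) has_real_derivative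
    p * gagliardo_form s p u f) (at 0)"
proof -
  have "increment (\<lambda>x. u x + t * f x) z = increment u z + t * increment f z" for t z
    by (simp add: increment_def algebra_simps)
  moreover have "(\<lambda>x. u x + t * f x) \<in> Wsp s p" for t
    using assms by (intro Wsp_add_cmult) auto
  ultimately show ?thesis
    using has_real_derivative_integral_abs_powr[OF assms(1) assms(2,3)[THEN WspD(4)]]
    by (simp add: gagliardo_form_def gagliardo_p_eq_integral)
qed

lemma gagliardo_form_eq_0_of_minimum:
  assumes "1 < p" "u \<in> Wsp s p" "f \<in> Wsp s p"
    and "\<And>t. gagliardo_p s p u \<le> gagliardo_p s p (\<lambda>x. u x + t * f x)"
  shows "gagliardo_form s p u f = 0"
proof -
  have "p * gagliardo_form s p u f = 0"
    using has_real_derivative_gagliardo_p[OF assms(1-3)] zero_less_one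
    by (rule DERIV_local_min) (use assms(4) in simp)
  then show ?thesis
    using assms(1) by simp
qed

lemma gagliardo_p_eq_0_iff:
  assumes "1 < p" "u \<in> Wsp s p"
  shows "gagliardo_p s p u = 0 \<longleftrightarrow> (\<forall>x y. u x = u y)"
proof
  assume "gagliardo_p s p u = 0"
  then have "u x - u y = 0 - 0" for x y
    using assms by (intro gagliardo_p_subgradient_eq[OF assms(1) Wsp_const[of 0] assms(2)])
      (simp_all add: gagliardo_p_const gagliardo_form_def increment_def)
  then show "\<forall>x y. u x = u y"
    by simp
next
  assume "\<forall>x y. u x = u y"
  then obtain c where "u = (\<lambda>_. c)"
    by blast
  then show "gagliardo_p s p u = 0"
    by (simp add: gagliardo_p_const)
qed

section \<open>Two-point minimizers and the dipole equation\<close>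

definition two_point_minimizer ::
  "real \<Rightarrow> real \<Rightarrow> 'a::euclidean_space \<Rightarrow> 'a \<Rightarrow> ('a \<Rightarrow> real) \<Rightarrow> bool" where
  "two_point_minimizer s p x0 y0 u \<longleftrightarrow> u \<in> Wsp s p \<and>
     (\<forall>f\<in>Wsp s p. f x0 = u x0 \<and> f y0 = u y0 \<longrightarrow> gagliardo_p s p u \<le> gagliardo_p s p f)"

lemma two_point_minimizerD:
  assumes "two_point_minimizer s p x0 y0 u"
  shows "u \<in> Wsp s p"
    and "f \<in> Wsp s p \<Longrightarrow> f x0 = u x0 \<Longrightarrow> f y0 = u y0 \<Longrightarrow> gagliardo_p s p u \<le> gagliardo_p s p f"
  using assms by (auto simp: two_point_minimizer_def)

lemma weak_dipole_solution_of_two_point_minimizer: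
  assumes p: "1 < p" and u: "two_point_minimizer s p x0 y0 u" "u x0 \<noteq> u y0"
  shows "\<exists>c. c \<noteq> 0 \<and> weak_dipole_solution s p u c x0 y0"
proof -
  note W = two_point_minimizerD(1)[OF u(1)]
  have vanish: "gagliardo_form s p u f = 0" if "f \<in> Wsp s p" "f x0 = 0" "f y0 = 0" for f
    using that p
    by (intro gagliardo_form_eq_0_of_minimum two_point_minimizerD[OF u(1)] Wsp_add_cmult W) auto
  define c where "c = gagliardo_p s p u / (u x0 - u y0)"
  have "gagliardo_form s p u f = c * (f x0 - f y0)" if f: "f \<in> Wsp s p" for f
  proof -
    define k where "k = - ((f x0 - f y0) / (u x0 - u y0))"
    define d where "d = - f y0 - k * u y0"
    have shifted: "(\<lambda>x. d + 1 * f x) \<in> Wsp s p"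
      using Wsp_affine[OF f, of 1 d] by (simp add: add.commute)
    have "(\<lambda>x. d + 1 * f x + k * u x) \<in> Wsp s p"
      using p by (intro Wsp_add_cmult shifted W) simp
    then have "gagliardo_form s p u (\<lambda>x. d + 1 * f x + k * u x) = 0"
      by (rule vanish) (use u(2) in \<open>simp_all add: d_def k_def field_simps\<close>)
    then have "gagliardo_form s p u f + k * gagliardo_p s p u = 0"
      using gagliardo_form_add_cmult[OF p W shifted W, of k]
        gagliardo_form_add_cmult[OF p W Wsp_const f, of d 1]
      by (simp add: gagliardo_form_const gagliardo_form_self[OF p W])
    then show ?thesis
      by (simp add: k_def c_def)
  qed
  moreover have "c \<noteq> 0"
    using u(2) gagliardo_p_eq_0_iff[OF p W] by (auto simp: c_def)
  ultimately show ?thesis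
    by (auto simp: weak_dipole_solution_iff[OF p W])
qed

lemma weak_dipole_solution_unique_minimizer:
  assumes p: "1 < p" and u: "u \<in> Wsp s p" "weak_dipole_solution s p u c x0 y0"
    and f: "f \<in> Wsp s p" "f x0 = u x0" "f y0 = u y0"
  shows "gagliardo_p s p u \<le> gagliardo_p s p f"
    and "gagliardo_p s p f = gagliardo_p s p u \<Longrightarrow> f = u"
proof -
  have "(\<lambda>x. f x - u x) \<in> Wsp s p"
    using p f(1) u(1) by (intro Wsp_diff) auto
  then have vanish: "gagliardo_form s p u (\<lambda>x. f x - u x) = 0"
    using u f(2,3) by (auto simp: weak_dipole_solution_iff[OF p])
  then show "gagliardo_p s p u \<le> gagliardo_p s p f"
    using gagliardo_p_subgradient[OF p u(1) f(1)] by simp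
  assume "gagliardo_p s p f = gagliardo_p s p u"
  then have "f x - f x0 = u x - u x0" for x
    using vanish by (intro gagliardo_p_subgradient_eq[OF p u(1) f(1)]) simp
  then show "f = u"
    using f(2) by auto
qed

lemma two_point_minimizer_eq_imp_const:
  fixes u :: "'a::euclidean_space \<Rightarrow> real"
  assumes "1 < p" "two_point_minimizer s p x0 y0 u" "u x0 = u y0"
  shows "u x = u y"
proof -
  have "gagliardo_p s p u \<le> gagliardo_p s p (\<lambda>_::'a. u x0)"
    using assms(3) by (intro two_point_minimizerD(2)[OF assms(2)] Wsp_const) simp_all
  then have "gagliardo_p s p u = 0"
    by (simp add: gagliardo_p_const order.antisym)
  then show ?thesis
    using gagliardo_p_eq_0_iff[OF assms(1) two_point_minimizerD(1)[OF assms(2)]] by blast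
qed

lemma unique_two_point_minimizer_iff:
  assumes p: "1 < p"
  shows "u \<in> Wsp s p \<and> (\<exists>x y. u x \<noteq> u y) \<and>
      (\<forall>f\<in>Wsp s p. f x0 = u x0 \<and> f y0 = u y0 \<longrightarrow>
        gagliardo_p s p u \<le> gagliardo_p s p f \<and> (gagliardo_p s p f = gagliardo_p s p u \<longrightarrow> f = u))
    \<longleftrightarrow> two_point_minimizer s p x0 y0 u \<and> u x0 \<noteq> u y0"
    (is "?unique \<longleftrightarrow> ?min")
proof
  assume ?unique
  then show ?min
    using two_point_minimizer_eq_imp_const[OF p, of s x0 y0 u]
    by (auto simp: two_point_minimizer_def)
next
  assume min: ?min
  then obtain c where c: "weak_dipole_solution s p u c x0 y0"
    using weak_dipole_solution_of_two_point_minimizer[OF p] by blast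
  have W: "u \<in> Wsp s p"
    using min two_point_minimizerD(1) by blast
  show ?unique
    using min W weak_dipole_solution_unique_minimizer[OF p W c] by blast
qed

section \<open>Similarities\<close>

lemma nn_integral_lborel_translate:
  fixes f :: "'a::euclidean_space \<Rightarrow> ennreal"
  assumes [measurable]: "f \<in> borel_measurable borel"
  shows "(\<integral>\<^sup>+x. f (c + x) \<partial>lborel) = (\<integral>\<^sup>+x. f x \<partial>lborel)"
  by (subst (2) lborel_distr_plus[of c, symmetric]) (simp add: nn_integral_distr)

lemma nn_integral_lborel_scale:
  fixes f :: "'a::euclidean_space \<Rightarrow> ennreal"
  assumes [measurable]: "f \<in> borel_measurable borel" and "0 < r"
  shows "(\<integral>\<^sup>+x. f (a + r *\<^sub>R x) \<partial>lborel) = ennreal (r powr - real DIM('a)) * (\<integral>\<^sup>+x. f x \<partial>lborel)"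
proof -
  have "(\<integral>\<^sup>+x. f x \<partial>lborel)
      = (\<integral>\<^sup>+x. f x \<partial>density (distr lborel borel (\<lambda>x. a + r *\<^sub>R x)) (\<lambda>_. \<bar>r\<bar> ^ DIM('a)))"
    using lborel_affine[of r a] assms(2) by simp
  also have "\<dots> = ennreal (r powr real DIM('a)) * (\<integral>\<^sup>+x. f (a + r *\<^sub>R x) \<partial>lborel)"
    using assms(2)
    by (simp add: nn_integral_density nn_integral_distr nn_integral_cmult powr_realpow)
  finally show ?thesis
    using assms(2) by (simp add: mult.assoc[symmetric] powr_add[symmetric] flip: ennreal_mult)
qed

text \<open>Fubini against the indicator of \<open>B\<close>, as in the proof that a translation invariant measure is
  unique up to a factor.\<close>

lemma emeasure_times_nn_integral_lborel_linear:
  fixes f :: "'a::euclidean_space \<Rightarrow> ennreal" and T :: "'a \<Rightarrow> 'a"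
  assumes [measurable]: "f \<in> borel_measurable borel" "B \<in> sets borel" and T: "linear T" "surj T"
  shows "emeasure lborel B * (\<integral>\<^sup>+x. f (T x) \<partial>lborel)
    = (\<integral>\<^sup>+y. emeasure lborel {x. y - T x \<in> B} * f y \<partial>lborel)"
proof -
  have "continuous_on UNIV T"
    using T(1) by (intro linear_continuous_on linear_linear[THEN iffD2])
  then have [measurable]: "T \<in> borel_measurable borel"
    by (rule borel_measurable_continuous_onI)
  have shift: "(\<integral>\<^sup>+x. f (y + T x) \<partial>lborel) = (\<integral>\<^sup>+x. f (T x) \<partial>lborel)" for y
  proof -
    obtain w where "y = T w"
      using T(2) by (rule surjE)
    then show ?thesis
      using nn_integral_lborel_translate[of "\<lambda>x. f (T x)" w] by (simp add: linear_add[OF T(1)])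
  qed
  have "emeasure lborel B * (\<integral>\<^sup>+x. f (T x) \<partial>lborel)
      = (\<integral>\<^sup>+y. \<integral>\<^sup>+x. indicator B y * f (y + T x) \<partial>lborel \<partial>lborel)"
    by (simp add: nn_integral_cmult nn_integral_multc shift)
  also have "\<dots> = (\<integral>\<^sup>+x. \<integral>\<^sup>+y. indicator B y * f (y + T x) \<partial>lborel \<partial>lborel)"
    by (rule lborel_pair.Fubini') measurable
  also have "\<dots> = (\<integral>\<^sup>+x. \<integral>\<^sup>+y. indicator B (y - T x) * f y \<partial>lborel \<partial>lborel)"
  proof (rule nn_integral_cong)
    show "(\<integral>\<^sup>+y. indicator B y * f (y + T x) \<partial>lborel)
        = (\<integral>\<^sup>+y. indicator B (y - T x) * f y \<partial>lborel)" for x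
      by (subst nn_integral_lborel_translate[symmetric, of "\<lambda>y. indicator B (y - T x) * f y" "T x"])
        (simp_all add: add.commute)
  qed
  also have "\<dots> = (\<integral>\<^sup>+y. \<integral>\<^sup>+x. indicator {x. y - T x \<in> B} x * f y \<partial>lborel \<partial>lborel)"
    by (subst lborel_pair.Fubini') (simp_all add: indicator_def)
  also have "\<dots> = (\<integral>\<^sup>+y. emeasure lborel {x. y - T x \<in> B} * f y \<partial>lborel)"
    by (simp add: nn_integral_multc)
  finally show ?thesis .
qed

lemma nn_integral_lborel_orthogonal:
  fixes f :: "'a::euclidean_space \<Rightarrow> ennreal" and T :: "'a \<Rightarrow> 'a"
  assumes "f \<in> borel_measurable borel" and T: "orthogonal_transformation T"
  shows "(\<integral>\<^sup>+x. f (T x) \<partial>lborel) = (\<integral>\<^sup>+x. f x \<partial>lborel)"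
proof -
  let ?B = "ball 0 1 :: 'a set"
  have T': "linear T" "surj T"
    using T by (simp_all add: orthogonal_transformation_linear orthogonal_transformation_surj)
  have preimage: "emeasure lborel {x. y - T x \<in> ?B} = emeasure lborel ?B" for y
  proof -
    obtain w where w: "y = T w"
      using T'(2) by (rule surjE)
    have "{x. y - T x \<in> ?B} = ball w 1"
      unfolding w linear_diff[OF T'(1), symmetric]
      by (auto simp: orthogonal_transformation_norm[OF T] dist_norm norm_minus_commute)
    then show ?thesis
      by (simp add: emeasure_ball)
  qed
  have "emeasure lborel ?B * (\<integral>\<^sup>+x. f (T x) \<partial>lborel) = emeasure lborel ?B * (\<integral>\<^sup>+x. f x \<partial>lborel)"
    using emeasure_times_nn_integral_lborel_linear[OF assms(1) _ T', of ?B] assms(1)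
    unfolding preimage by (simp add: nn_integral_cmult)
  moreover have "emeasure lborel ?B \<noteq> 0"
    using less_imp_neq[OF unit_ball_vol_pos[of "real DIM('a)"]] by (simp add: emeasure_ball)
  moreover have "emeasure lborel ?B \<noteq> top"
    using emeasure_lborel_ball_finite[of "0::'a" 1] by auto
  ultimately show ?thesis
    by (simp add: ennreal_mult_cancel_left)
qed

definition similarity :: "real \<Rightarrow> ('a::euclidean_space \<Rightarrow> 'a) \<Rightarrow> bool" where
  "similarity r S \<longleftrightarrow> 0 < r \<and> (\<exists>a T. orthogonal_transformation T \<and> S = (\<lambda>x. a + r *\<^sub>R T x))"

lemma similarityE:
  assumes "similarity r S"
  obtains a T where "0 < r" "orthogonal_transformation T" "S = (\<lambda>x. a + r *\<^sub>R T x)"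
  using assms by (auto simp: similarity_def)

lemma similarity_norm:
  assumes "similarity r S"
  shows "norm (S x - S y) = r * norm (x - y)"
  using assms
proof (rule similarityE)
  fix a T
  assume S: "0 < r" "orthogonal_transformation T" "S = (\<lambda>x. a + r *\<^sub>R T x)"
  have "S x - S y = r *\<^sub>R T (x - y)"
    by (simp add: S(3) linear_diff[OF orthogonal_transformation_linear[OF S(2)]] scaleR_diff_right)
  then show ?thesis
    using S(1) by (simp add: orthogonal_transformation_norm[OF S(2)])
qed

lemma similarity_continuous_on:
  assumes "similarity r S"
  shows "continuous_on UNIV S"
  using assms
proof (rule similarityE)
  fix a T
  assume S: "orthogonal_transformation T" "S = (\<lambda>x. a + r *\<^sub>R T x)"
  then have "continuous_on UNIV T"
    by (intro linear_continuous_on linear_linear[THEN iffD2] orthogonal_transformation_linear)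
  then show ?thesis
    unfolding S(2) by (intro continuous_intros)
qed

lemma nn_integral_lborel_similarity:
  fixes f :: "'a::euclidean_space \<Rightarrow> ennreal"
  assumes [measurable]: "f \<in> borel_measurable borel" and "similarity r S"
  shows "(\<integral>\<^sup>+x. f (S x) \<partial>lborel) = ennreal (r powr - real DIM('a)) * (\<integral>\<^sup>+x. f x \<partial>lborel)"
  using assms(2)
proof (rule similarityE)
  fix a T
  assume S: "0 < r" "orthogonal_transformation T" "S = (\<lambda>x. a + r *\<^sub>R T x)"
  have "(\<integral>\<^sup>+x. f (S x) \<partial>lborel) = (\<integral>\<^sup>+x. f (a + r *\<^sub>R x) \<partial>lborel)"
    unfolding S(3) by (rule nn_integral_lborel_orthogonal[OF _ S(2)]) measurable
  then show ?thesis
    using nn_integral_lborel_scale[OF assms(1) S(1)] by simp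
qed

lemma gagliardo_enn_similarity:
  fixes f :: "'a::euclidean_space \<Rightarrow> real"
  assumes [measurable]: "f \<in> borel_measurable borel" and S: "similarity r S"
  shows "gagliardo_enn s p (\<lambda>x. f (S x))
    = ennreal (r powr (s * p - real DIM('a))) * gagliardo_enn s p f"
proof -
  let ?q = "real DIM('a) + s * p" and ?c = "ennreal (r powr - real DIM('a))"
  define d where "d x y = ennreal (\<bar>f x - f y\<bar> powr p / norm (x - y) powr ?q)" for x y
  have [measurable]: "S \<in> borel_measurable borel"
    using similarity_continuous_on[OF S] by (rule borel_measurable_continuous_onI)
  have [measurable]: "(\<lambda>(x, y). d x y) \<in> borel_measurable (borel \<Otimes>\<^sub>M borel)"
    unfolding d_def by measurable
  have "0 < r"
    using S by (simp add: similarity_def)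
  then have "ennreal (\<bar>f (S x) - f (S y)\<bar> powr p / norm (x - y) powr ?q)
      = ennreal (r powr ?q) * d (S x) (S y)" for x y
    by (simp add: d_def similarity_norm[OF S] powr_mult flip: ennreal_mult)
  then have "gagliardo_enn s p (\<lambda>x. f (S x))
      = ennreal (r powr ?q) * (\<integral>\<^sup>+x. \<integral>\<^sup>+y. d (S x) (S y) \<partial>lborel \<partial>lborel)"
    by (simp add: gagliardo_enn_eq_iterated nn_integral_cmult)
  also have "(\<integral>\<^sup>+x. \<integral>\<^sup>+y. d (S x) (S y) \<partial>lborel \<partial>lborel)
      = (\<integral>\<^sup>+x. ?c * \<integral>\<^sup>+y. d (S x) y \<partial>lborel \<partial>lborel)"
    by (intro nn_integral_cong nn_integral_lborel_similarity[OF _ S]) measurable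
  also have "\<dots> = ?c * (\<integral>\<^sup>+x. \<integral>\<^sup>+y. d (S x) y \<partial>lborel \<partial>lborel)"
    by (intro nn_integral_cmult) measurable
  also have "(\<integral>\<^sup>+x. \<integral>\<^sup>+y. d (S x) y \<partial>lborel \<partial>lborel) = ?c * (\<integral>\<^sup>+x. \<integral>\<^sup>+y. d x y \<partial>lborel \<partial>lborel)"
    by (rule nn_integral_lborel_similarity[OF _ S]) measurable
  also have "(\<integral>\<^sup>+x. \<integral>\<^sup>+y. d x y \<partial>lborel \<partial>lborel) = gagliardo_enn s p f"
    by (simp add: gagliardo_enn_eq_iterated d_def)
  finally show ?thesis
    by (simp add: mult.assoc[symmetric] powr_add[symmetric] flip: ennreal_mult)
qed

lemma Wsp_similarity:
  fixes f :: "'a::euclidean_space \<Rightarrow> real"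
  assumes f: "f \<in> Wsp s p" and S: "similarity r S"
  shows "(\<lambda>x. f (S x)) \<in> Wsp s p"
proof -
  let ?\<alpha> = "alpha_sp s p DIM('a)"
  obtain C where C: "0 \<le> C" "\<And>x y. \<bar>f x - f y\<bar> \<le> C * norm (x - y) powr ?\<alpha>"
    using holder_boundedE[OF WspD(3)[OF f]] by blast
  have "0 < r"
    using S by (simp add: similarity_def)
  have "holder_bounded ?\<alpha> (\<lambda>x. f (S x))"
  proof (rule holder_boundedI)
    show "\<bar>f (S x) - f (S y)\<bar> \<le> (C * r powr ?\<alpha>) * norm (x - y) powr ?\<alpha>" for x y
      using C(2)[of "S x" "S y"] \<open>0 < r\<close> by (simp add: similarity_norm[OF S] powr_mult mult.assoc)
  qed
  moreover have "continuous_on UNIV (\<lambda>x. f (S x))"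
    using continuous_on_compose2[OF WspD(1)[OF f] similarity_continuous_on[OF S]] by simp
  moreover have "gagliardo_enn s p (\<lambda>x. f (S x)) < \<infinity>"
    using f by (simp add: gagliardo_enn_similarity[OF WspD(2)[OF f] S] gagliardo_enn_eq_ennreal
        ennreal_mult_less_top)
  ultimately show ?thesis
    by (simp add: Wsp_def)
qed

lemma gagliardo_p_similarity:
  fixes f :: "'a::euclidean_space \<Rightarrow> real"
  assumes "f \<in> borel_measurable borel" "similarity r S"
  shows "gagliardo_p s p (\<lambda>x. f (S x)) = r powr (s * p - real DIM('a)) * gagliardo_p s p f"
  by (simp add: gagliardo_p_def gagliardo_enn_similarity[OF assms] enn2real_mult)

lemma orthogonal_transformation_reflection:
  fixes v :: "'a::euclidean_space"
  shows "orthogonal_transformation (\<lambda>x. x - (2 * (x \<bullet> v) / (v \<bullet> v)) *\<^sub>R v)"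
    (is "orthogonal_transformation ?R")
proof -
  have "linear ?R"
    by (rule linearI) (simp_all add: inner_add_left add_divide_distrib distrib_left
        scaleR_add_left scaleR_diff_right)
  moreover have "?R x \<bullet> ?R y = x \<bullet> y" for x y
  proof (cases "v = 0")
    case False
    define d where "d = v \<bullet> v"
    have "d \<noteq> 0"
      using False by (simp add: d_def)
    then show ?thesis
      unfolding inner_diff_left inner_diff_right inner_scaleR_left inner_scaleR_right
        inner_commute[of v y] d_def[symmetric]
      by (simp add: field_simps)
  qed simp
  ultimately show ?thesis
    unfolding orthogonal_transformation_def by blast
qed

lemma orthogonal_transformation_exists_euclidean:
  fixes a b :: "'a::euclidean_space"
  assumes "norm a = norm b"
  shows "\<exists>T. orthogonal_transformation T \<and> T a = b"
proof (cases "a = b")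
  case False
  let ?v = "a - b"
  have "a \<bullet> a = b \<bullet> b"
    using assms by (simp add: norm_eq)
  then have "2 * (a \<bullet> ?v) = ?v \<bullet> ?v"
    by (simp add: inner_diff_left inner_diff_right inner_commute)
  then have "a - (2 * (a \<bullet> ?v) / (?v \<bullet> ?v)) *\<^sub>R ?v = b"
    using False by simp
  then show ?thesis
    using orthogonal_transformation_reflection[of ?v] by blast
qed (auto intro!: exI[of _ "\<lambda>x. x"])

lemma similarity_exists:
  fixes x0 y0 x y :: "'a::euclidean_space"
  assumes "x0 \<noteq> y0" "x \<noteq> y"
  shows "\<exists>S. similarity (norm (x - y) / norm (x0 - y0)) S \<and> S x0 = x \<and> S y0 = y"
proof -
  let ?r = "norm (x - y) / norm (x0 - y0)"
  have "0 < ?r"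
    using assms by simp
  have "norm (x0 - y0) = norm ((1 / ?r) *\<^sub>R (x - y))"
    using assms by simp
  then obtain T where T: "orthogonal_transformation T" "T (x0 - y0) = (1 / ?r) *\<^sub>R (x - y)"
    using orthogonal_transformation_exists_euclidean by blast
  define S where "S w = (y - ?r *\<^sub>R T y0) + ?r *\<^sub>R T w" for w
  have "S x0 = y + ?r *\<^sub>R T (x0 - y0)"
    by (simp add: S_def linear_diff[OF orthogonal_transformation_linear[OF T(1)]] scaleR_diff_right)
  also have "\<dots> = x"
    unfolding T(2) using assms by simp
  finally have "S x0 = x" .
  moreover have "S y0 = y"
    by (simp add: S_def)
  moreover have "similarity ?r S"
    using \<open>0 < ?r\<close> T(1) unfolding similarity_def S_def by blast
  ultimately show ?thesis
    by blast
qed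

lemma similarity_scale: "0 < r \<Longrightarrow> similarity r (\<lambda>x. r *\<^sub>R x)"
  unfolding similarity_def by (auto intro!: exI[of _ 0] exI[of _ "\<lambda>x. x"])

lemma similarity_translate: "similarity 1 (\<lambda>x. c + x)"
  unfolding similarity_def by (auto intro!: exI[of _ c] exI[of _ "\<lambda>x. x"])

lemma Wsp_dilate:
  assumes "f \<in> Wsp s p" "0 < t"
  shows "(\<lambda>x. f (t *\<^sub>R x)) \<in> Wsp s p"
  using Wsp_similarity[OF assms(1) similarity_scale[OF assms(2)]] .

lemma gagliardo_p_dilate_tendsto_0:
  fixes f :: "'a::euclidean_space \<Rightarrow> real"
  assumes "f \<in> borel_measurable borel" "real DIM('a) < s * p"
  shows "((\<lambda>t. gagliardo_p s p (\<lambda>x. f (t *\<^sub>R x))) \<longlongrightarrow> 0) (at_right 0)"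
proof -
  let ?d = "s * p - real DIM('a)"
  have "((\<lambda>t. t powr ?d) \<longlongrightarrow> 0 powr ?d) (at_right 0)"
    using assms(2) eventually_at_right_less[of "0::real"]
    by (intro tendsto_powr' tendsto_ident_at tendsto_const) (auto elim: eventually_mono)
  then have "((\<lambda>t. t powr ?d * gagliardo_p s p f) \<longlongrightarrow> 0 * gagliardo_p s p f) (at_right 0)"
    by (intro tendsto_mult tendsto_const) simp
  moreover have "eventually (\<lambda>t. t powr ?d * gagliardo_p s p f = gagliardo_p s p (\<lambda>x. f (t *\<^sub>R x)))
      (at_right 0)"
    using eventually_at_right_less
    by eventually_elim (simp add: gagliardo_p_similarity[OF assms(1) similarity_scale])
  ultimately show ?thesis
    by (simp add: Lim_transform_eventually)
qed

section \<open>Lipschitz functions with bounded support\<close>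

lemma nn_integral_lborel_scale_power:
  fixes g :: "'a::euclidean_space \<Rightarrow> ennreal"
  assumes "g \<in> borel_measurable borel" "0 < t"
  shows "ennreal ((t ^ k) powr - \<gamma>) * (\<integral>\<^sup>+h. g (t ^ k *\<^sub>R h) \<partial>lborel)
    = ennreal ((t powr - (\<gamma> + real DIM('a))) ^ k) * (\<integral>\<^sup>+h. g h \<partial>lborel)"
proof -
  have "(t ^ k) powr a = (t powr a) ^ k" for a
    using assms(2) by (simp add: powr_powr mult.commute flip: powr_realpow)
  then have "(t ^ k) powr - \<gamma> * (t ^ k) powr - real DIM('a) = (t powr - (\<gamma> + real DIM('a))) ^ k"
    by (simp flip: powr_add power_mult_distrib)
  then show ?thesis
    using nn_integral_lborel_scale[OF assms(1), of "t ^ k" 0] assms(2)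
    by (simp add: mult.assoc[symmetric] flip: ennreal_mult)
qed

lemma nn_integral_norm_powr_annulus_finite:
  "(\<integral>\<^sup>+h\<in>{h. 1 \<le> norm h \<and> norm h < 2}. ennreal (norm h powr \<gamma>)
    \<partial>(lborel :: 'a::euclidean_space measure)) < \<infinity>"
proof -
  have "norm h powr \<gamma> \<le> max 1 (2 powr \<gamma>)" if "1 \<le> norm h" "norm h < 2" for h :: 'a
    using that powr_mono2[of \<gamma> "norm h" 2] powr_mono2'[of \<gamma> 1 "norm h"]
    by (cases "0 \<le> \<gamma>") (auto simp: le_max_iff_disj)
  then have "(\<integral>\<^sup>+h\<in>{h. 1 \<le> norm h \<and> norm h < 2}. ennreal (norm h powr \<gamma>) \<partial>(lborel :: 'a measure))
      \<le> (\<integral>\<^sup>+h\<in>ball 0 2. ennreal (max 1 (2 powr \<gamma>)) \<partial>(lborel :: 'a measure))"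
    by (intro nn_integral_mono) (auto simp: indicator_def intro!: ennreal_leI)
  also have "\<dots> < \<infinity>"
    using emeasure_lborel_ball_finite[of "0::'a" 2]
    by (simp add: nn_integral_cmult_indicator ennreal_mult_less_top)
  finally show ?thesis .
qed

text \<open>By scaling, the contributions of the annuli \<open>t\<^sup>-\<^sup>k \<le> |h| < 2 t\<^sup>-\<^sup>k\<close> form a geometric series.\<close>

lemma nn_integral_norm_powr_geometric:
  fixes A :: "'a::euclidean_space set"
  assumes "0 < t" and ratio: "t powr - (\<gamma> + real DIM('a)) < 1"
    and cover: "\<And>h. h \<in> A \<Longrightarrow> \<exists>k. 1 \<le> t ^ k * norm h \<and> t ^ k * norm h < 2"
  shows "(\<integral>\<^sup>+h\<in>A. ennreal (norm h powr \<gamma>) \<partial>lborel) < \<infinity>"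
proof -
  let ?q = "t powr - (\<gamma> + real DIM('a))"
  define g :: "'a \<Rightarrow> ennreal" where
    "g h = ennreal (norm h powr \<gamma>) * indicator {h. 1 \<le> norm h \<and> norm h < 2} h" for h
  have [measurable]: "g \<in> borel_measurable borel"
    unfolding g_def by measurable
  have "ennreal (norm h powr \<gamma>) * indicator A h
      \<le> (\<Sum>k. ennreal ((t ^ k) powr - \<gamma>) * g (t ^ k *\<^sub>R h))" for h
  proof (cases "h \<in> A")
    case True
    then obtain k where k: "1 \<le> t ^ k * norm h" "t ^ k * norm h < 2"
      using cover by blast
    have "norm h powr \<gamma> = (t ^ k) powr - \<gamma> * norm (t ^ k *\<^sub>R h) powr \<gamma>"
      using \<open>0 < t\<close> by (simp add: powr_mult powr_minus field_simps)
    then have "ennreal (norm h powr \<gamma>) * indicator A h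
        = (\<Sum>k\<in>{k}. ennreal ((t ^ k) powr - \<gamma>) * g (t ^ k *\<^sub>R h))"
      using k True \<open>0 < t\<close> by (simp add: g_def flip: ennreal_mult)
    also have "\<dots> \<le> (\<Sum>k. ennreal ((t ^ k) powr - \<gamma>) * g (t ^ k *\<^sub>R h))"
      by (intro sum_le_suminf) auto
    finally show ?thesis .
  qed simp
  then have "(\<integral>\<^sup>+h\<in>A. ennreal (norm h powr \<gamma>) \<partial>lborel)
      \<le> (\<integral>\<^sup>+h. (\<Sum>k. ennreal ((t ^ k) powr - \<gamma>) * g (t ^ k *\<^sub>R h)) \<partial>lborel)"
    by (intro nn_integral_mono)
  also have "\<dots> = (\<Sum>k. ennreal ((t ^ k) powr - \<gamma>) * (\<integral>\<^sup>+h. g (t ^ k *\<^sub>R h) \<partial>lborel))"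
    by (simp add: nn_integral_suminf nn_integral_cmult)
  also have "\<dots> = (\<Sum>k. ennreal (?q ^ k) * (\<integral>\<^sup>+h. g h \<partial>lborel))"
    using \<open>0 < t\<close> by (simp add: nn_integral_lborel_scale_power)
  also have "\<dots> < \<infinity>"
    using nn_integral_norm_powr_annulus_finite[where ?'a = 'a, of \<gamma>] ratio summable_geometric[of ?q]
    by (simp add: suminf_ennreal2 ennreal_mult_less_top g_def)
  finally show ?thesis .
qed

lemma nn_integral_norm_powr_outside:
  assumes "\<gamma> + real DIM('a) < 0"
  shows "(\<integral>\<^sup>+h\<in>{h. 1 \<le> norm h}. ennreal (norm h powr \<gamma>)
    \<partial>(lborel :: 'a::euclidean_space measure)) < \<infinity>"
proof (rule nn_integral_norm_powr_geometric[where t = "1 / 2"])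
  show "(1 / 2) powr - (\<gamma> + real DIM('a)) < 1"
    using assms powr_less_mono2[of "- (\<gamma> + real DIM('a))" "1 / 2" 1] by simp
  fix h :: 'a
  assume h: "h \<in> {h. 1 \<le> norm h}"
  then have "0 < norm h"
    by auto
  define k where "k = \<lfloor>log 2 (norm h)\<rfloor>"
  have "2 powr k \<le> norm h" "norm h < 2 powr (k + 1)"
    using floor_log_eq_powr_iff[of "norm h" 2 k] \<open>0 < norm h\<close> by (simp_all add: k_def)
  moreover have "0 \<le> k"
    using h \<open>0 < norm h\<close> by (simp add: k_def zero_le_log_cancel_iff)
  then have "2 powr k = 2 ^ nat k" "2 powr (k + 1) = 2 * 2 ^ nat k"
    by (auto simp: powr_add powr_real_of_int)
  ultimately show "\<exists>k. 1 \<le> (1 / 2) ^ k * norm h \<and> (1 / 2) ^ k * norm h < 2"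
    by (intro exI[of _ "nat k"]) (simp add: power_one_over field_simps)
qed auto

lemma nn_integral_norm_powr_inside:
  assumes "0 < \<gamma> + real DIM('a)"
  shows "(\<integral>\<^sup>+h\<in>{h. 0 < norm h \<and> norm h < 1}. ennreal (norm h powr \<gamma>)
    \<partial>(lborel :: 'a::euclidean_space measure)) < \<infinity>"
proof (rule nn_integral_norm_powr_geometric[where t = 2])
  show "2 powr - (\<gamma> + real DIM('a)) < 1"
    using assms powr_less_mono[of "- (\<gamma> + real DIM('a))" 0 2] by simp
  fix h :: 'a
  assume h: "h \<in> {h. 0 < norm h \<and> norm h < 1}"
  define k where "k = \<lfloor>log 2 (norm h)\<rfloor>"
  have "2 powr k \<le> norm h" "norm h < 2 powr (k + 1)"
    using h floor_log_eq_powr_iff[of "norm h" 2 k] by (auto simp: k_def)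
  moreover have "k < 0"
    using h by (simp add: k_def floor_less_iff)
  then have "2 powr k = 1 / 2 ^ nat (- k)" "2 powr (k + 1) = 2 / 2 ^ nat (- k)"
    by (auto simp: powr_add powr_real_of_int inverse_eq_divide)
  ultimately have "1 / 2 ^ nat (- k) \<le> norm h" "norm h < 2 / 2 ^ nat (- k)"
    by simp_all
  then show "\<exists>k. 1 \<le> 2 ^ k * norm h \<and> 2 ^ k * norm h < 2"
    by (intro exI[of _ "nat (- k)"]) (simp add: field_simps)
qed simp

lemma nn_integral_min_powr_divide_finite:
  assumes "0 \<le> p" "0 \<le> L" "0 \<le> M" and q: "real DIM('a) < q" "q < p + real DIM('a)"
  shows "(\<integral>\<^sup>+h. ennreal (min (L * norm h) M powr p / norm h powr q)
    \<partial>(lborel :: 'a::euclidean_space measure)) < \<infinity>"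
proof -
  let ?inside = "\<lambda>h::'a. ennreal (norm h powr (p - q)) * indicator {h. 0 < norm h \<and> norm h < 1} h"
  let ?outside = "\<lambda>h::'a. ennreal (norm h powr (- q)) * indicator {h. 1 \<le> norm h} h"
  have "ennreal (min (L * norm h) M powr p / norm h powr q)
      \<le> ennreal (L powr p) * ?inside h + ennreal (M powr p) * ?outside h" for h
  proof (cases "h = 0")
    case False
    have "min (L * norm h) M powr p / norm h powr q \<le> (L * norm h) powr p / norm h powr q"
      "min (L * norm h) M powr p / norm h powr q \<le> M powr p / norm h powr q"
      using assms by (auto intro!: divide_right_mono powr_mono2)
    then show ?thesis
      using False by (auto simp: indicator_def powr_mult powr_diff powr_minus_divide
          simp flip: ennreal_mult intro!: ennreal_leI)
  qed simp
  then have "(\<integral>\<^sup>+h. ennreal (min (L * norm h) M powr p / norm h powr q) \<partial>(lborel :: 'a measure))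
      \<le> (\<integral>\<^sup>+h. ennreal (L powr p) * ?inside h + ennreal (M powr p) * ?outside h \<partial>lborel)"
    by (intro nn_integral_mono)
  also have "\<dots> = ennreal (L powr p) * (\<integral>\<^sup>+h. ?inside h \<partial>lborel)
      + ennreal (M powr p) * (\<integral>\<^sup>+h. ?outside h \<partial>lborel)"
    by (subst nn_integral_add) (simp_all add: nn_integral_cmult)
  also have "\<dots> < \<infinity>"
    using nn_integral_norm_powr_inside[where ?'a = 'a, of "p - q"]
      nn_integral_norm_powr_outside[where ?'a = 'a, of "- q"] q
    by (simp add: ennreal_mult_less_top)
  finally show ?thesis .
qed

lemma gagliardo_enn_support_le:
  fixes f :: "'a::euclidean_space \<Rightarrow> real" and g :: "'a \<Rightarrow> ennreal"
  assumes [measurable]: "f \<in> borel_measurable borel" "g \<in> borel_measurable borel" "K \<in> sets borel"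
    and supp: "\<And>x. x \<notin> K \<Longrightarrow> f x = 0" and even: "\<And>h. g (- h) = g h"
    and le: "\<And>x y. ennreal (\<bar>f x - f y\<bar> powr p
      / norm (x - y) powr (real DIM('a) + s * p)) \<le> g (x - y)"
  shows "gagliardo_enn s p f \<le> 2 * (emeasure lborel K * (\<integral>\<^sup>+h. g h \<partial>lborel))"
proof -
  have slice: "(\<integral>\<^sup>+y. g (y - x) \<partial>lborel) = (\<integral>\<^sup>+h. g h \<partial>lborel)" for x
    using nn_integral_lborel_translate[of g "- x"] by simp
  have slice': "(\<integral>\<^sup>+y. g (x - y) \<partial>lborel) = (\<integral>\<^sup>+h. g h \<partial>lborel)" for x
    using slice[of x] even[of "x - _"] by simp
  have "ennreal (\<bar>f x - f y\<bar> powr p / norm (x - y) powr (real DIM('a) + s * p))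
      \<le> indicator K x * g (x - y) + indicator K y * g (x - y)" for x y
    using le[of x y] supp[of x] supp[of y] by (auto simp: indicator_def add_increasing2)
  then have "gagliardo_enn s p f
      \<le> (\<integral>\<^sup>+x. \<integral>\<^sup>+y. indicator K x * g (x - y) + indicator K y * g (x - y) \<partial>lborel \<partial>lborel)"
    by (simp add: gagliardo_enn_eq_iterated nn_integral_mono)
  also have "\<dots> = (\<integral>\<^sup>+x. \<integral>\<^sup>+y. indicator K x * g (x - y) \<partial>lborel \<partial>lborel)
      + (\<integral>\<^sup>+x. \<integral>\<^sup>+y. indicator K y * g (x - y) \<partial>lborel \<partial>lborel)"
    by (simp add: nn_integral_add)
  also have "(\<integral>\<^sup>+x. \<integral>\<^sup>+y. indicator K y * g (x - y) \<partial>lborel \<partial>lborel)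
      = (\<integral>\<^sup>+y. \<integral>\<^sup>+x. indicator K y * g (x - y) \<partial>lborel \<partial>lborel)"
    by (rule lborel_pair.Fubini') measurable
  finally show ?thesis
    by (simp add: nn_integral_cmult nn_integral_multc slice slice' mult_2)
qed

lemma alpha_sp_times_p:
  assumes "p \<noteq> 0"
  shows "alpha_sp s p N * p = s * p - real N"
  using assms by (simp add: alpha_sp_def field_simps)

lemma alpha_sp_pos:
  assumes "0 < p" "real N < s * p"
  shows "0 < alpha_sp s p N"
  using assms by (simp add: alpha_sp_def field_simps)

lemma continuous_bounded_support_imp_bounded:
  fixes f :: "'a::heine_borel \<Rightarrow> 'b::real_normed_vector"
  assumes "continuous_on UNIV f" "bounded {x. f x \<noteq> 0}"
  obtains M where "0 \<le> M" "\<And>x. norm (f x) \<le> M"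
proof -
  have "compact (f ` closure {x. f x \<noteq> 0})"
    using assms by (intro compact_continuous_image) (auto intro: continuous_on_subset)
  then obtain M where M: "\<And>x. x \<in> closure {x. f x \<noteq> 0} \<Longrightarrow> norm (f x) \<le> M"
    using compact_imp_bounded[of "f ` closure {x. f x \<noteq> 0}"] by (auto simp: bounded_iff)
  have "norm (f x) \<le> max M 0" for x
    using M[of x] closure_subset[of "{x. f x \<noteq> 0}"] by (cases "f x = 0") auto
  then show ?thesis
    using that[of "max M 0"] by simp
qed

lemma lipschitz_on_UNIV_realD:
  fixes f :: "'a::real_normed_vector \<Rightarrow> real"
  assumes "L-lipschitz_on UNIV f"
  shows "0 \<le> L" "\<bar>f x - f y\<bar> \<le> L * norm (x - y)"
  using lipschitz_onD[OF assms, of x y] lipschitz_on_nonneg[OF assms] by (auto simp: dist_norm)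

lemma holder_bounded_lipschitz:
  fixes f :: "'a::euclidean_space \<Rightarrow> real"
  assumes lip: "L-lipschitz_on UNIV f" and M: "\<And>x y. \<bar>f x - f y\<bar> \<le> M" and \<alpha>: "0 \<le> \<alpha>" "\<alpha> \<le> 1"
  shows "holder_bounded \<alpha> f"
proof (rule holder_boundedI)
  fix x y
  note L = lipschitz_on_UNIV_realD[OF lip]
  have "0 \<le> M"
    using M[of x y] by simp
  show "\<bar>f x - f y\<bar> \<le> max L M * norm (x - y) powr \<alpha>"
  proof (cases "norm (x - y) \<le> 1")
    case True
    have "L * norm (x - y) powr 1 \<le> max L M * norm (x - y) powr \<alpha>"
      using True \<alpha> L(1) by (intro mult_mono powr_mono') auto
    then show ?thesis
      using L(2)[of x y] by simp
  next
    case False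
    then have "1 \<le> norm (x - y) powr \<alpha>"
      using \<alpha> by (intro ge_one_powr_ge_zero) auto
    then have "M * 1 \<le> max L M * norm (x - y) powr \<alpha>"
      using \<open>0 \<le> M\<close> by (intro mult_mono) auto
    then show ?thesis
      using M[of x y] by simp
  qed
qed

lemma gagliardo_enn_lipschitz_bounded_support_finite:
  fixes f :: "'a::euclidean_space \<Rightarrow> real"
  assumes sp: "0 < s" "s < 1" "0 < p"
    and lip: "L-lipschitz_on UNIV f" and supp: "bounded {x. f x \<noteq> 0}"
    and M: "0 \<le> M" "\<And>x y. \<bar>f x - f y\<bar> \<le> M"
  shows "gagliardo_enn s p f < \<infinity>"
proof -
  let ?K = "{x. f x \<noteq> 0}" and ?q = "real DIM('a) + s * p"
  define g where "g h = ennreal (min (L * norm h) M powr p / norm h powr ?q)" for h :: 'a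
  note L = lipschitz_on_UNIV_realD[OF lip]
  have [measurable]: "f \<in> borel_measurable borel"
    using lip by (intro borel_measurable_continuous_onI lipschitz_on_continuous_on)
  have "(\<integral>\<^sup>+h. g h \<partial>lborel) < \<infinity>"
    unfolding g_def using sp L(1) M(1) by (intro nn_integral_min_powr_divide_finite) auto
  moreover have "emeasure lborel ?K < \<infinity>"
    using supp by (rule emeasure_bounded_finite)
  moreover have "gagliardo_enn s p f \<le> 2 * (emeasure lborel ?K * (\<integral>\<^sup>+h. g h \<partial>lborel))"
  proof (rule gagliardo_enn_support_le)
    show "ennreal (\<bar>f x - f y\<bar> powr p / norm (x - y) powr ?q) \<le> g (x - y)" for x y
      unfolding g_def using L(2)[of x y] M(2)[of x y] sp(3)
      by (intro ennreal_leI divide_right_mono powr_mono2) auto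
  qed (simp_all add: g_def)
  ultimately show ?thesis
    by (auto intro: order.strict_trans1 simp: ennreal_mult_less_top)
qed

lemma Wsp_lipschitz_bounded_support:
  fixes f :: "'a::euclidean_space \<Rightarrow> real"
  assumes sp: "s < 1" "0 < p" "real DIM('a) \<le> s * p"
    and lip: "L-lipschitz_on UNIV f" and supp: "bounded {x. f x \<noteq> 0}"
  shows "f \<in> Wsp s p"
proof -
  have cont: "continuous_on UNIV f"
    using lip by (rule lipschitz_on_continuous_on)
  obtain B where B: "0 \<le> B" "\<And>x. norm (f x) \<le> B"
    using continuous_bounded_support_imp_bounded[OF cont supp] by blast
  have diff: "\<bar>f x - f y\<bar> \<le> 2 * B" for x y
    using B(2)[of x] B(2)[of y] by simp
  have "0 \<le> alpha_sp s p DIM('a)"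
    using sp by (simp add: alpha_sp_def field_simps)
  moreover have "0 \<le> real DIM('a) / p"
    using sp by simp
  then have "alpha_sp s p DIM('a) \<le> 1"
    using sp(1) unfolding alpha_sp_def by linarith
  ultimately have "holder_bounded (alpha_sp s p DIM('a)) f"
    by (rule holder_bounded_lipschitz[OF lip diff])
  moreover have "0 < s * p"
    using sp(3) DIM_positive[where 'a = 'a] by linarith
  then have "0 < s"
    using sp(2) by (simp add: zero_less_mult_iff)
  then have "gagliardo_enn s p f < \<infinity>"
    using B(1)
    by (intro gagliardo_enn_lipschitz_bounded_support_finite[OF _ sp(1,2) lip supp _ diff]) auto
  ultimately show ?thesis
    using cont by (simp add: Wsp_def)
qed

lemma hat_in_Wsp:
  fixes x0 :: "'a::euclidean_space"
  assumes "s < 1" "0 < p" "real DIM('a) \<le> s * p"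
  shows "(\<lambda>x. max 0 (r - norm (x - x0))) \<in> Wsp s p"
proof (rule Wsp_lipschitz_bounded_support[OF assms])
  show "1-lipschitz_on UNIV (\<lambda>x. max 0 (r - norm (x - x0)))"
  proof (rule lipschitz_onI)
    show "dist (max 0 (r - norm (x - x0))) (max 0 (r - norm (y - x0))) \<le> 1 * dist x y" for x y
      using norm_triangle_ineq3[of "x - x0" "y - x0"] by (auto simp: dist_norm max_def)
  qed simp
  have "{x. max 0 (r - norm (x - x0)) \<noteq> 0} \<subseteq> ball x0 r"
    by (auto simp: dist_norm norm_minus_commute)
  then show "bounded {x. max 0 (r - norm (x - x0)) \<noteq> 0}"
    by (rule bounded_subset[OF bounded_ball])
qed

section \<open>Smooth functions\<close>

lemma smooth_fun_coinduct:
  fixes f :: "'a::euclidean_space \<Rightarrow> real"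
  assumes "f \<in> C" and cont: "\<And>g. g \<in> C \<Longrightarrow> continuous_on UNIV g"
    and deriv: "\<And>g v. g \<in> C \<Longrightarrow> v \<in> Basis \<Longrightarrow>
      \<exists>g'\<in>C. \<forall>x. ((\<lambda>t. g (x + t *\<^sub>R v)) has_real_derivative g' x) (at 0)"
  shows "smooth_fun f"
proof -
  have "partial_deriv v g \<in> C" if gv: "g \<in> C" "v \<in> Basis" for g v
  proof -
    obtain g' where g': "g' \<in> C" "\<And>x. ((\<lambda>t. g (x + t *\<^sub>R v)) has_real_derivative g' x) (at 0)"
      using deriv[OF gv] by blast
    have "partial_deriv v g = g'"
      using g'(2) by (intro ext) (simp add: partial_deriv_def DERIV_imp_deriv)
    then show ?thesis
      using g'(1) by simp
  qed
  then have "foldr partial_deriv vs f \<in> C" if "set vs \<subseteq> Basis" for vs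
    using that \<open>f \<in> C\<close> by (induction vs) auto
  then show ?thesis
    unfolding smooth_fun_def using cont deriv by (meson real_differentiable_def)
qed

lemma smooth_fun_continuous_on: "smooth_fun f \<Longrightarrow> continuous_on S f"
  unfolding smooth_fun_def by (auto dest!: spec[of _ "[]"] intro: continuous_on_subset)

lemma smooth_fun_partial_deriv:
  assumes "smooth_fun f" "v \<in> Basis"
  shows "smooth_fun (partial_deriv v f)"
  unfolding smooth_fun_def
proof (intro allI impI)
  fix vs :: "'a list"
  assume "set vs \<subseteq> Basis"
  then have "set (vs @ [v]) \<subseteq> Basis"
    using assms(2) by simp
  moreover have "foldr partial_deriv vs (partial_deriv v f) = foldr partial_deriv (vs @ [v]) f"
    by simp
  ultimately show "continuous_on UNIV (foldr partial_deriv vs (partial_deriv v f)) \<and>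
      (\<forall>w\<in>Basis. \<forall>x. (\<lambda>t. foldr partial_deriv vs (partial_deriv v f) (x + t *\<^sub>R w))
        differentiable (at 0))"
    using assms(1) unfolding smooth_fun_def by presburger
qed

lemma smooth_fun_has_partial_deriv:
  assumes "smooth_fun f" "v \<in> Basis"
  shows "((\<lambda>t. f (x + t *\<^sub>R v)) has_real_derivative partial_deriv v f (x + t *\<^sub>R v)) (at t)"
proof -
  have "(\<lambda>h. f ((x + t *\<^sub>R v) + h *\<^sub>R v)) differentiable (at 0)"
    using assms unfolding smooth_fun_def by (auto dest!: spec[of _ "[]"])
  then have "((\<lambda>h. f ((x + t *\<^sub>R v) + h *\<^sub>R v)) has_real_derivative
      partial_deriv v f (x + t *\<^sub>R v)) (at 0)"
    by (simp add: partial_deriv_def DERIV_deriv_iff_real_differentiable)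
  then show ?thesis
    using DERIV_shift[of "\<lambda>t. f (x + t *\<^sub>R v)" _ 0 t] by (simp add: algebra_simps)
qed

lemma smooth_fun_divide:
  fixes f :: "'a::euclidean_space \<Rightarrow> real"
  assumes "smooth_fun f"
  shows "smooth_fun (\<lambda>x. f x / c)"
proof (rule smooth_fun_coinduct[where C = "{\<lambda>x. g x / c | g. smooth_fun g}"])
  fix g :: "'a \<Rightarrow> real" and v :: 'a
  assume "g \<in> {\<lambda>x. g x / c | g. smooth_fun g}" and v: "v \<in> Basis"
  then obtain h where g: "g = (\<lambda>x. h x / c)" and h: "smooth_fun h"
    by blast
  have "((\<lambda>t. g (x + t *\<^sub>R v)) has_real_derivative partial_deriv v h x / c) (at 0)" for x
    using smooth_fun_has_partial_deriv[OF h v, of x 0] unfolding g by (intro DERIV_cdivide) simp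
  then show "\<exists>g'\<in>{\<lambda>x. g x / c | g. smooth_fun g}.
      \<forall>x. ((\<lambda>t. g (x + t *\<^sub>R v)) has_real_derivative g' x) (at 0)"
    using smooth_fun_partial_deriv[OF h v]
    by (intro bexI[of _ "\<lambda>x. partial_deriv v h x / c"]) auto
next
  show "continuous_on UNIV g" if "g \<in> {\<lambda>x. g x / c | g. smooth_fun g}" for g :: "'a \<Rightarrow> real"
    using that unfolding divide_inverse
    by (auto intro!: continuous_on_mult_right[OF smooth_fun_continuous_on])
qed (use assms in blast)

lemma prod_coordinates_line:
  fixes H :: "'a::euclidean_space \<Rightarrow> real \<Rightarrow> real"
  assumes "v \<in> Basis"
  shows "(\<Prod>i\<in>Basis. H i ((x + t *\<^sub>R v) \<bullet> i)) = H v (x \<bullet> v + t) * (\<Prod>i\<in>Basis - {v}. H i (x \<bullet> i))"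
  using assms by (subst prod.remove[OF _ assms])
    (auto simp: inner_add_left inner_Basis split: if_splits intro!: prod.cong)

lemma smooth_fun_prod_coordinates:
  fixes G :: "'a::euclidean_space \<Rightarrow> real \<Rightarrow> real"
  assumes "\<And>i. smooth_fun (G i)"
  shows "smooth_fun (\<lambda>x. \<Prod>i\<in>Basis. G i (x \<bullet> i))"
proof (rule smooth_fun_coinduct[where C = "{\<lambda>x. \<Prod>i\<in>Basis. G i (x \<bullet> i) | G. \<forall>i. smooth_fun (G i)}"])
  let ?C = "{\<lambda>x :: 'a. \<Prod>i\<in>Basis. G i (x \<bullet> i) | G. \<forall>i. smooth_fun (G i)}"
  fix g :: "'a \<Rightarrow> real"
  assume "g \<in> ?C"
  then obtain G where g: "g = (\<lambda>x. \<Prod>i\<in>Basis. G i (x \<bullet> i))" and G: "\<And>i. smooth_fun (G i)"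
    by blast
  show "continuous_on UNIV g"
    unfolding g
    by (intro continuous_on_prod continuous_on_compose2[OF smooth_fun_continuous_on[OF G, of UNIV]]
        continuous_intros) auto
  fix v :: 'a
  assume v: "v \<in> Basis"
  let ?G' = "G(v := partial_deriv 1 (G v))"
  have "((\<lambda>t. g (x + t *\<^sub>R v)) has_real_derivative (\<Prod>i\<in>Basis. ?G' i (x \<bullet> i))) (at 0)" for x
  proof -
    have "((\<lambda>t. G v (x \<bullet> v + t)) has_real_derivative partial_deriv 1 (G v) (x \<bullet> v)) (at 0)"
      using smooth_fun_has_partial_deriv[OF G, of 1 v "x \<bullet> v" 0] by simp
    moreover have "(\<Prod>i\<in>Basis. ?G' i (x \<bullet> i))
        = partial_deriv 1 (G v) (x \<bullet> v) * (\<Prod>i\<in>Basis - {v}. G i (x \<bullet> i))"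
      using prod_coordinates_line[OF v, of ?G' x 0] by (simp cong: prod.cong_simp)
    ultimately show ?thesis
      unfolding g prod_coordinates_line[OF v] by (simp add: DERIV_cmult_right)
  qed
  moreover have "smooth_fun (?G' i)" for i
    using G smooth_fun_partial_deriv[OF G, of 1 v] by simp
  ultimately show "\<exists>g'\<in>?C. \<forall>x. ((\<lambda>t. g (x + t *\<^sub>R v)) has_real_derivative g' x) (at 0)"
    by (intro bexI[of _ "\<lambda>x. \<Prod>i\<in>Basis. ?G' i (x \<bullet> i)"]) blast+
qed (use assms in blast)

lemma continuous_on_mult_translate:
  fixes f k :: "'a::euclidean_space \<Rightarrow> real" and X :: "'b::topological_space \<Rightarrow> 'a"
  assumes "continuous_on S f" "continuous_on UNIV k" "continuous_on U X"
  shows "continuous_on (U \<times> S) (\<lambda>(x, y). f y * k (X x - y))"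
  unfolding split_beta
  by (intro continuous_on_mult continuous_on_compose2[OF assms(1)] continuous_on_diff
      continuous_on_compose2[OF assms(2)] continuous_on_compose2[OF assms(3)] continuous_intros)
    auto

lemma has_real_derivative_integral_translates:
  fixes f k :: "'a::euclidean_space \<Rightarrow> real"
  assumes f: "continuous_on (cbox a b) f" and k: "smooth_fun k" and v: "v \<in> Basis"
  shows "((\<lambda>t. integral (cbox a b) (\<lambda>y. f y * k (x + t *\<^sub>R v - y))) has_real_derivative
    integral (cbox a b) (\<lambda>y. f y * partial_deriv v k (x + 0 *\<^sub>R v - y))) (at 0 within UNIV)"
proof (rule leibniz_rule_field_derivative)
  fix t y
  show "((\<lambda>t. f y * k (x + t *\<^sub>R v - y)) has_real_derivative
      f y * partial_deriv v k (x + t *\<^sub>R v - y)) (at t within UNIV)"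
    using smooth_fun_has_partial_deriv[OF k v, of "x - y" t]
    by (intro DERIV_cmult) (simp add: add_diff_eq diff_add_eq)
  show "(\<lambda>y. f y * k (x + t *\<^sub>R v - y)) integrable_on cbox a b"
    by (intro integrable_continuous continuous_on_mult f continuous_intros
        continuous_on_compose2[OF smooth_fun_continuous_on[OF k, of UNIV]]) auto
next
  show "continuous_on (UNIV \<times> cbox a b) (\<lambda>(t, y). f y * partial_deriv v k (x + t *\<^sub>R v - y))"
    by (intro continuous_on_mult_translate f smooth_fun_continuous_on smooth_fun_partial_deriv k v
        continuous_intros)
qed auto

lemma smooth_fun_integral_translates:
  fixes f k :: "'a::euclidean_space \<Rightarrow> real"
  assumes f: "continuous_on (cbox a b) f" and k: "smooth_fun k"
  shows "smooth_fun (\<lambda>x. integral (cbox a b) (\<lambda>y. f y * k (x - y)))"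
proof -
  define I where "I k x = integral (cbox a b) (\<lambda>y. f y * k (x - y))" for k x
  have "smooth_fun (I k)"
  proof (rule smooth_fun_coinduct[where C = "I ` {k. smooth_fun k}"])
    fix g
    assume "g \<in> I ` {k. smooth_fun k}"
    then obtain k where g: "g = I k" and k: "smooth_fun k"
      by blast
    show "continuous_on UNIV g"
      unfolding g I_def[abs_def]
      by (intro integral_continuous_on_param continuous_on_mult_translate f
          smooth_fun_continuous_on k continuous_on_id)
    fix v :: 'a
    assume v: "v \<in> Basis"
    have "((\<lambda>t. g (x + t *\<^sub>R v)) has_real_derivative I (partial_deriv v k) x) (at 0)" for x
      using has_real_derivative_integral_translates[OF f k v, of x] by (simp add: g I_def)
    then show "\<exists>g'\<in>I ` {k. smooth_fun k}.
        \<forall>x. ((\<lambda>t. g (x + t *\<^sub>R v)) has_real_derivative g' x) (at 0)"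
      using smooth_fun_partial_deriv[OF k v] by blast
  qed (use k in blast)
  then show ?thesis
    by (simp add: I_def[abs_def])
qed

definition flat_exp :: "nat \<Rightarrow> real \<Rightarrow> real" where
  "flat_exp m t = (if 0 < t then inverse t ^ m * exp (- inverse t) else 0)"

lemma flat_exp_nonneg: "0 \<le> flat_exp m t"
  by (simp add: flat_exp_def)

lemma mult_flat_exp_Suc: "t * flat_exp (Suc m) t = flat_exp m t"
  by (simp add: flat_exp_def)

lemma flat_exp_tendsto_0: "(flat_exp m \<longlongrightarrow> 0) (at 0)"
proof (rule filterlim_split_at)
  have "eventually (\<lambda>t. 0 = flat_exp m t) (at_left 0)"
    by (auto simp: eventually_at_left_field flat_exp_def intro!: exI[of _ "-1"])
  then show "(flat_exp m \<longlongrightarrow> 0) (at_left 0)"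
    by (rule Lim_transform_eventually[OF tendsto_const])
  have "((\<lambda>t::real. inverse t ^ m / exp (inverse t)) \<longlongrightarrow> 0) (at_right 0)"
    by (rule filterlim_compose[OF tendsto_power_div_exp_0 filterlim_inverse_at_top_right])
  moreover have "eventually (\<lambda>t. inverse t ^ m / exp (inverse t) = flat_exp m t) (at_right 0)"
    by (auto simp: eventually_at_right_field flat_exp_def exp_minus divide_inverse
        intro!: exI[of _ 1])
  ultimately show "(flat_exp m \<longlongrightarrow> 0) (at_right 0)"
    by (rule Lim_transform_eventually)
qed

lemma has_real_derivative_flat_exp:
  "(flat_exp m has_real_derivative flat_exp (m + 2) t - real m * flat_exp (m + 1) t) (at t)"
proof (cases t "0::real" rule: linorder_cases)
  case less
  have "(flat_exp m has_real_derivative 0) (at t)"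
    by (rule DERIV_cong_ev[THEN iffD1, of t t "\<lambda>_. 0"])
      (use less eventually_nhds_in_open[of "{..<0}" t] in
        \<open>auto elim!: eventually_mono simp: flat_exp_def\<close>)
  then show ?thesis
    using less by (simp add: flat_exp_def)
next
  case equal
  have "eventually (\<lambda>h. flat_exp (Suc m) h = flat_exp m h / h) (at 0)"
    using mult_flat_exp_Suc[of _ m] by (auto simp: eventually_at_filter field_simps)
  then have "((\<lambda>h. flat_exp m h / h) \<longlongrightarrow> 0) (at 0)"
    by (rule Lim_transform_eventually[OF flat_exp_tendsto_0])
  then show ?thesis
    by (simp add: equal DERIV_def flat_exp_def)
next
  case greater
  have "((\<lambda>t. inverse t ^ m) has_real_derivative
      real m * (- (inverse t ^ Suc (Suc 0)) * inverse t ^ (m - Suc 0))) (at t)"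
    using greater by (intro DERIV_power[OF DERIV_inverse]) simp
  then have "((\<lambda>t. inverse t ^ m) has_real_derivative - (real m * inverse t ^ (m + 1))) (at t)"
    by (rule DERIV_cong) (cases m; simp)
  moreover have "((\<lambda>t. exp (- inverse t)) has_real_derivative
      inverse t ^ 2 * exp (- inverse t)) (at t)"
    using greater by (auto intro!: derivative_eq_intros simp: power2_eq_square)
  ultimately have "((\<lambda>t. inverse t ^ m * exp (- inverse t)) has_real_derivative
      flat_exp (m + 2) t - real m * flat_exp (m + 1) t) (at t)"
    by (rule DERIV_cong[OF DERIV_mult])
      (use greater in \<open>simp add: flat_exp_def power2_eq_square algebra_simps\<close>)
  then show ?thesis
    by (rule DERIV_cong_ev[THEN iffD1, rotated -1])
      (use greater eventually_nhds_in_open[of "{0<..}" t] in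
        \<open>auto elim!: eventually_mono simp: flat_exp_def\<close>)
qed

lemma has_real_derivative_poly_mult_flat_exp:
  fixes Q :: "real poly" and m :: nat and r t :: real
  defines "Q' \<equiv> pderiv Q * [:r\<^sup>2, 0, -1:]\<^sup>2 - [:0, 2:] * Q * (1 - smult (real m) [:r\<^sup>2, 0, -1:])"
  shows "((\<lambda>t. poly Q t * flat_exp m (r\<^sup>2 - t\<^sup>2)) has_real_derivative
    poly Q' t * flat_exp (m + 2) (r\<^sup>2 - t\<^sup>2)) (at t)"
proof -
  let ?w = "r\<^sup>2 - t\<^sup>2"
  have reduce: "flat_exp (m + 1) ?w = ?w * flat_exp (m + 2) ?w"
    "flat_exp m ?w = ?w\<^sup>2 * flat_exp (m + 2) ?w"
    using mult_flat_exp_Suc[of ?w "m + 1"] mult_flat_exp_Suc[of ?w m]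
    by (simp_all add: power2_eq_square mult.assoc)
  have "((\<lambda>t. poly Q t * flat_exp m (r\<^sup>2 - t\<^sup>2)) has_real_derivative
      poly (pderiv Q) t * flat_exp m ?w
      + (flat_exp (m + 2) ?w - real m * flat_exp (m + 1) ?w) * (- (2 * t)) * poly Q t) (at t)"
    by (rule DERIV_mult[OF poly_DERIV DERIV_chain2[OF has_real_derivative_flat_exp]])
      (auto intro!: derivative_eq_intros)
  also have "poly (pderiv Q) t * flat_exp m ?w
      + (flat_exp (m + 2) ?w - real m * flat_exp (m + 1) ?w) * (- (2 * t)) * poly Q t
      = poly Q' t * flat_exp (m + 2) ?w"
    unfolding reduce Q'_def by (simp add: power2_eq_square algebra_simps)
  finally show ?thesis .
qed

lemma smooth_fun_flat_exp_bump: "smooth_fun (\<lambda>t. flat_exp 0 (r\<^sup>2 - t\<^sup>2))"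
proof (rule smooth_fun_coinduct[where C = "range (\<lambda>(Q, m) t. poly Q t * flat_exp m (r\<^sup>2 - t\<^sup>2))"])
  let ?C = "range (\<lambda>(Q, m) t. poly Q t * flat_exp m (r\<^sup>2 - t\<^sup>2))"
  show "(\<lambda>t. flat_exp 0 (r\<^sup>2 - t\<^sup>2)) \<in> ?C"
    by (rule range_eqI[of _ _ "(1, 0)"]) simp
  have deriv: "\<exists>g'\<in>?C. \<forall>t. (g has_real_derivative g' t) (at t)" if "g \<in> ?C" for g
    using that has_real_derivative_poly_mult_flat_exp by fastforce
  then show "continuous_on UNIV g" if "g \<in> ?C" for g
    using that by (meson DERIV_isCont continuous_at_imp_continuous_on)
  fix g and v :: real
  assume "g \<in> ?C" "v \<in> Basis"
  then obtain g' where g': "g' \<in> ?C" "\<And>t. (g has_real_derivative g' t) (at t)"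
    using deriv by blast
  have "((\<lambda>t. g (x + t *\<^sub>R v)) has_real_derivative g' x) (at 0)" for x
    using g'(2)[of x] \<open>v \<in> Basis\<close> DERIV_shift[of g "g' x" 0 x] by (simp add: add.commute)
  then show "\<exists>g'\<in>?C. \<forall>x. ((\<lambda>t. g (x + t *\<^sub>R v)) has_real_derivative g' x) (at 0)"
    using g'(1) by (intro bexI[of _ g']) simp_all
qed

section \<open>Test functions\<close>

lemma test_fun_iff: "test_fun f \<longleftrightarrow> smooth_fun f \<and> bounded {x. f x \<noteq> 0}"
  by (simp add: test_fun_def)

lemma test_fun_divide: "test_fun f \<Longrightarrow> test_fun (\<lambda>x. f x / c)"
  by (auto simp: test_fun_iff smooth_fun_divide elim: bounded_subset)

lemma partial_deriv_support: "{x. partial_deriv v f x \<noteq> 0} \<subseteq> closure {x. f x \<noteq> 0}"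
proof -
  have "partial_deriv v f x = 0" if "x \<notin> closure {x. f x \<noteq> 0}" for x
  proof -
    have "open ((\<lambda>t. x + t *\<^sub>R v) -` (- closure {x. f x \<noteq> 0}))"
      by (intro open_vimage continuous_intros) (simp add: open_Compl)
    then have "eventually (\<lambda>t. t \<in> (\<lambda>t. x + t *\<^sub>R v) -` (- closure {x. f x \<noteq> 0})) (nhds 0)"
      using that by (intro eventually_nhds_in_open) simp_all
    then have "eventually (\<lambda>t. f (x + t *\<^sub>R v) = 0) (nhds 0)"
      by eventually_elim (use closure_subset[of "{x. f x \<noteq> 0}"] in auto)
    then have "((\<lambda>t. f (x + t *\<^sub>R v)) has_real_derivative 0) (at 0)"
      by (subst DERIV_cong_ev[OF refl _ refl]) auto
    then show ?thesis
      unfolding partial_deriv_def by (rule DERIV_imp_deriv)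
  qed
  then show ?thesis
    by blast
qed

lemma test_fun_partial_deriv:
  assumes "test_fun f" "v \<in> Basis"
  shows "test_fun (partial_deriv v f)"
  using assms bounded_subset[OF bounded_closure partial_deriv_support, of f v]
  by (simp add: test_fun_iff smooth_fun_partial_deriv)

text \<open>Move one coordinate at a time.\<close>

lemma lipschitz_on_coordinatewise:
  fixes f :: "'a::euclidean_space \<Rightarrow> real"
  assumes "0 \<le> B" and step: "\<And>x t v. v \<in> Basis \<Longrightarrow> \<bar>f (x + t *\<^sub>R v) - f x\<bar> \<le> B * \<bar>t\<bar>"
  shows "(B * real DIM('a))-lipschitz_on UNIV f"
proof (rule lipschitz_onI)
  have telescope: "\<bar>f (x + (\<Sum>b\<in>A. c b *\<^sub>R b)) - f x\<bar> \<le> B * (\<Sum>b\<in>A. \<bar>c b\<bar>)"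
    if "finite A" "A \<subseteq> Basis" for A x c
    using that
  proof (induction A arbitrary: x rule: finite_induct)
    case (insert b A)
    have "\<bar>f (x + (\<Sum>b\<in>insert b A. c b *\<^sub>R b)) - f x\<bar>
        \<le> \<bar>f ((x + c b *\<^sub>R b) + (\<Sum>b\<in>A. c b *\<^sub>R b)) - f (x + c b *\<^sub>R b)\<bar> + \<bar>f (x + c b *\<^sub>R b) - f x\<bar>"
      using insert.hyps by (simp add: add.assoc)
    also have "\<dots> \<le> B * (\<Sum>b\<in>A. \<bar>c b\<bar>) + B * \<bar>c b\<bar>"
      using insert by (intro add_mono insert.IH step) auto
    finally show ?case
      using insert by (simp add: distrib_left)
  qed simp
  fix x y :: 'a
  have "\<bar>f (y + (\<Sum>b\<in>Basis. ((x - y) \<bullet> b) *\<^sub>R b)) - f y\<bar> \<le> B * (\<Sum>b\<in>Basis. \<bar>(x - y) \<bullet> b\<bar>)"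
    by (rule telescope) auto
  also have "\<dots> \<le> B * (\<Sum>b\<in>(Basis::'a set). norm (x - y))"
    using \<open>0 \<le> B\<close> by (intro mult_left_mono sum_mono Basis_le_norm)
  finally show "dist (f x) (f y) \<le> B * real DIM('a) * dist x y"
    by (simp add: euclidean_representation dist_norm mult.assoc)
qed (use \<open>0 \<le> B\<close> in simp)

lemma test_fun_lipschitz:
  fixes f :: "'a::euclidean_space \<Rightarrow> real"
  assumes "test_fun f"
  obtains L where "L-lipschitz_on UNIV f"
proof -
  have "\<exists>M\<ge>0. \<forall>x. \<bar>partial_deriv v f x\<bar> \<le> M" if "v \<in> Basis" for v
  proof -
    have "continuous_on UNIV (partial_deriv v f)" "bounded {x. partial_deriv v f x \<noteq> 0}"
      using test_fun_partial_deriv[OF assms that]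
      by (simp_all add: test_fun_iff smooth_fun_continuous_on)
    then obtain M where "0 \<le> M" "\<And>x. norm (partial_deriv v f x) \<le> M"
      using continuous_bounded_support_imp_bounded by blast
    then show ?thesis
      by auto
  qed
  then obtain M where M: "\<And>v. v \<in> Basis \<Longrightarrow> 0 \<le> M v" "\<And>v x. v \<in> Basis \<Longrightarrow> \<bar>partial_deriv v f x\<bar> \<le> M v"
    by metis
  have "\<bar>f (x + t *\<^sub>R v) - f x\<bar> \<le> sum M Basis * \<bar>t\<bar>" if v: "v \<in> Basis" for x t v
  proof -
    have "smooth_fun f"
      using assms by (simp add: test_fun_iff)
    have "\<bar>f (x + t *\<^sub>R v) - f (x + 0 *\<^sub>R v)\<bar> \<le> M v * \<bar>t - 0\<bar>"
      using field_differentiable_bound[of UNIV "\<lambda>t. f (x + t *\<^sub>R v)"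
          "\<lambda>t. partial_deriv v f (x + t *\<^sub>R v)" "M v" t 0]
        smooth_fun_has_partial_deriv[OF \<open>smooth_fun f\<close> v, of x] M(2)[OF v] by simp
    also have "\<dots> \<le> sum M Basis * \<bar>t - 0\<bar>"
      using v M(1) by (intro mult_right_mono member_le_sum) auto
    finally show ?thesis
      by simp
  qed
  moreover have "0 \<le> sum M Basis"
    using M(1) by (rule sum_nonneg)
  ultimately have "(sum M Basis * real DIM('a))-lipschitz_on UNIV f"
    by (intro lipschitz_on_coordinatewise)
  then show ?thesis
    by (rule that)
qed

lemma test_fun_in_Wsp:
  fixes f :: "'a::euclidean_space \<Rightarrow> real"
  assumes "s < 1" "0 < p" "real DIM('a) \<le> s * p" "test_fun f"
  shows "f \<in> Wsp s p"
proof -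
  obtain L where "L-lipschitz_on UNIV f"
    using assms(4) by (rule test_fun_lipschitz)
  then show ?thesis
    using assms by (intro Wsp_lipschitz_bounded_support) (auto simp: test_fun_iff)
qed

section \<open>Mollification\<close>

definition mollifier :: "real \<Rightarrow> ('a::euclidean_space \<Rightarrow> real) \<Rightarrow> bool" where
  "mollifier r k \<longleftrightarrow> smooth_fun k \<and> (\<forall>z. 0 \<le> k z) \<and> (\<forall>z. k z \<noteq> 0 \<longrightarrow> norm z < r)
     \<and> (\<integral>z. k z \<partial>lborel) = 1"

definition convolution :: "('a::euclidean_space \<Rightarrow> real) \<Rightarrow> ('a \<Rightarrow> real) \<Rightarrow> 'a \<Rightarrow> real" where
  "convolution k f x = (\<integral>z. k z * f (x - z) \<partial>lborel)"

lemma integrable_continuous_bounded_support: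
  fixes h :: "'a::euclidean_space \<Rightarrow> real"
  assumes "continuous_on UNIV h" "bounded {x. h x \<noteq> 0}"
  shows "integrable lborel h"
proof -
  let ?K = "closure {x. h x \<noteq> 0}"
  have "integrable lborel (\<lambda>x. indicator ?K x *\<^sub>R h x)"
    using assms by (intro borel_integrable_compact) (auto intro: continuous_on_subset)
  moreover have "(\<lambda>x. indicator ?K x *\<^sub>R h x) = h"
    using closure_subset[of "{x. h x \<noteq> 0}"] by (intro ext) (auto simp: indicator_def)
  ultimately show ?thesis
    by simp
qed

lemma integral_lborel_reflect:
  fixes h :: "'a::euclidean_space \<Rightarrow> real"
  assumes [measurable]: "h \<in> borel_measurable borel"
  shows "(\<integral>y. h (x - y) \<partial>lborel) = (\<integral>y. h y \<partial>lborel)"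
proof -
  have "lborel = distr lborel borel (\<lambda>y. x - y)"
    using lborel_affine[of "-1" x] by (simp add: density_1)
  then have "(\<integral>y. h y \<partial>lborel) = (\<integral>y. h y \<partial>distr lborel borel (\<lambda>y. x - y))"
    by simp
  also have "\<dots> = (\<integral>y. h (x - y) \<partial>lborel)"
    by (rule integral_distr) measurable
  finally show ?thesis ..
qed

lemma mollifierD:
  assumes "mollifier r k"
  shows "smooth_fun k" "continuous_on UNIV k" "\<And>z. 0 \<le> k z" "\<And>z. k z \<noteq> 0 \<Longrightarrow> norm z < r"
    "(\<integral>z. k z \<partial>lborel) = 1" "bounded {z. k z \<noteq> 0}" "test_fun k" "integrable lborel k"
proof -
  show "smooth_fun k" "\<And>z. 0 \<le> k z" "\<And>z. k z \<noteq> 0 \<Longrightarrow> norm z < r" "(\<integral>z. k z \<partial>lborel) = 1"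
    using assms by (auto simp: mollifier_def)
  then show "continuous_on UNIV k" and "bounded {z. k z \<noteq> 0}"
    by (auto simp: bounded_iff intro: smooth_fun_continuous_on less_imp_le)
  then show "integrable lborel k" "test_fun k"
    using \<open>smooth_fun k\<close> by (auto intro: integrable_continuous_bounded_support simp: test_fun_iff)
qed

lemma smooth_bump_exists:
  assumes "0 < r"
  shows "\<exists>\<rho> :: 'a::euclidean_space \<Rightarrow> real. smooth_fun \<rho> \<and> (\<forall>z. 0 \<le> \<rho> z)
    \<and> (\<forall>z. \<rho> z \<noteq> 0 \<longrightarrow> norm z < r) \<and> \<rho> 0 \<noteq> 0"
proof -
  let ?d = "r / real DIM('a)"
  define \<rho> :: "'a \<Rightarrow> real" where "\<rho> z = (\<Prod>i\<in>Basis. flat_exp 0 (?d\<^sup>2 - (z \<bullet> i)\<^sup>2))" for z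
  have "smooth_fun \<rho>"
    unfolding \<rho>_def by (intro smooth_fun_prod_coordinates[where G = "\<lambda>_ t. flat_exp 0 (?d\<^sup>2 - t\<^sup>2)"]
        smooth_fun_flat_exp_bump)
  moreover have "0 \<le> \<rho> z" for z
    by (simp add: \<rho>_def prod_nonneg flat_exp_nonneg)
  moreover have "norm z < r" if "\<rho> z \<noteq> 0" for z
  proof -
    have "\<bar>z \<bullet> i\<bar> < ?d" if i: "i \<in> Basis" for i
    proof (rule power2_less_imp_less)
      have "flat_exp 0 (?d\<^sup>2 - (z \<bullet> i)\<^sup>2) \<noteq> 0"
        using \<open>\<rho> z \<noteq> 0\<close> i by (simp add: \<rho>_def)
      then show "\<bar>z \<bullet> i\<bar>\<^sup>2 < ?d\<^sup>2"
        by (simp add: flat_exp_def split: if_splits)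
    qed (use assms in simp)
    then have "(\<Sum>i\<in>Basis. \<bar>z \<bullet> i\<bar>) < (\<Sum>i\<in>(Basis::'a set). ?d)"
      by (intro sum_strict_mono) auto
    then show ?thesis
      using norm_le_l1[of z] by simp
  qed
  moreover have "\<rho> 0 \<noteq> 0"
    using assms by (simp add: \<rho>_def flat_exp_def)
  ultimately show ?thesis
    by blast
qed

lemma integral_lborel_continuous_pos:
  fixes h :: "'a::euclidean_space \<Rightarrow> real"
  assumes "continuous_on UNIV h" "integrable lborel h" "\<And>z. 0 \<le> h z" "h x \<noteq> 0"
  shows "0 < (\<integral>z. h z \<partial>lborel)"
proof -
  have "(\<integral>z. h z \<partial>lborel) \<noteq> 0"
  proof
    assume "(\<integral>z. h z \<partial>lborel) = 0"
    then have "AE z in lborel. h z = 0"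
      using integral_nonneg_eq_0_iff_AE[OF assms(2)] assms(3) by simp
    then show False
      using AE_lborel_continuous_imp_eq_0[OF assms(1)] assms(4) by blast
  qed
  moreover have "0 \<le> (\<integral>z. h z \<partial>lborel)"
    using assms(3) by (intro Bochner_Integration.integral_nonneg)
  ultimately show ?thesis
    by simp
qed

lemma mollifier_exists:
  assumes "0 < r"
  shows "\<exists>k :: 'a::euclidean_space \<Rightarrow> real. mollifier r k"
proof -
  obtain \<rho> :: "'a \<Rightarrow> real" where \<rho>: "smooth_fun \<rho>" "\<And>z. 0 \<le> \<rho> z" "\<And>z. \<rho> z \<noteq> 0 \<Longrightarrow> norm z < r" "\<rho> 0 \<noteq> 0"
    using smooth_bump_exists[OF assms] by blast
  have "bounded {z. \<rho> z \<noteq> 0}"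
    using \<rho>(3) by (auto simp: bounded_iff intro: less_imp_le)
  then have "integrable lborel \<rho>"
    using \<rho>(1) by (intro integrable_continuous_bounded_support smooth_fun_continuous_on)
  then have "0 < (\<integral>z. \<rho> z \<partial>lborel)"
    using \<rho> by (intro integral_lborel_continuous_pos smooth_fun_continuous_on)
  then have "mollifier r (\<lambda>z. \<rho> z / (\<integral>z. \<rho> z \<partial>lborel))"
    using smooth_fun_divide[OF \<rho>(1)] \<rho>(2,3) by (simp add: mollifier_def)
  then show ?thesis
    by blast
qed

lemma convolution_eq_integral_cbox:
  fixes f k :: "'a::euclidean_space \<Rightarrow> real"
  assumes k: "continuous_on UNIV k" and f: "continuous_on UNIV f"
    and support: "{x. f x \<noteq> 0} \<subseteq> cbox a b"
  shows "convolution k f x = integral (cbox a b) (\<lambda>y. f y * k (x - y))"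
proof -
  let ?h = "\<lambda>y. f y * k (x - y)"
  have cont: "continuous_on UNIV ?h"
    by (intro continuous_on_mult f continuous_on_compose2[OF k] continuous_intros) auto
  have "bounded {y. ?h y \<noteq> 0}"
    using support by (intro bounded_subset[OF bounded_cbox[of a b]]) auto
  then have "(\<integral>y. ?h y \<partial>lborel) = integral UNIV ?h"
    using cont by (intro integral_lborel[symmetric] integrable_continuous_bounded_support)
  also have "\<dots> = integral UNIV (\<lambda>y. if y \<in> cbox a b then ?h y else 0)"
    using support by (intro arg_cong[where f = "integral UNIV"] ext) auto
  also have "\<dots> = integral (cbox a b) ?h"
    by (rule integral_restrict_UNIV)
  finally show ?thesis
    using integral_lborel_reflect[OF borel_measurable_continuous_onI[OF cont], of x]
    by (simp add: convolution_def mult.commute)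
qed

lemma bounded_support_convolution:
  fixes f k :: "'a::euclidean_space \<Rightarrow> real"
  assumes "bounded {z. k z \<noteq> 0}" "bounded {x. f x \<noteq> 0}"
  shows "bounded {x. convolution k f x \<noteq> 0}"
proof (rule bounded_subset[OF bounded_sums[OF assms]])
  show "{x. convolution k f x \<noteq> 0} \<subseteq> (\<Union>z\<in>{z. k z \<noteq> 0}. \<Union>y\<in>{y. f y \<noteq> 0}. {z + y})"
  proof
    fix x
    assume "x \<in> {x. convolution k f x \<noteq> 0}"
    then have "(\<lambda>z. k z * f (x - z)) \<noteq> (\<lambda>z. 0)"
      by (auto simp: convolution_def)
    then obtain z where "k z \<noteq> 0" "f (x - z) \<noteq> 0"
      by (auto simp: fun_eq_iff)
    then show "x \<in> (\<Union>z\<in>{z. k z \<noteq> 0}. \<Union>y\<in>{y. f y \<noteq> 0}. {z + y})"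
      by force
  qed
qed

lemma test_fun_convolution:
  fixes f k :: "'a::euclidean_space \<Rightarrow> real"
  assumes k: "test_fun k" and f: "continuous_on UNIV f" "bounded {x. f x \<noteq> 0}"
  shows "test_fun (convolution k f)"
proof -
  obtain a b where "{x. f x \<noteq> 0} \<subseteq> cbox a b"
    using bounded_subset_cbox_symmetric[OF f(2)] by blast
  then have "convolution k f = (\<lambda>x. integral (cbox a b) (\<lambda>y. f y * k (x - y)))"
    using k f(1)
    by (intro ext convolution_eq_integral_cbox)
      (simp_all add: test_fun_iff smooth_fun_continuous_on)
  then have "smooth_fun (convolution k f)"
    using k by (simp add: test_fun_iff smooth_fun_integral_translates continuous_on_subset[OF f(1)])
  then show ?thesis
    using k f(2) by (simp add: test_fun_iff bounded_support_convolution)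
qed

lemma integrable_mollifier_mult:
  fixes f k :: "'a::euclidean_space \<Rightarrow> real"
  assumes "mollifier r k" "continuous_on UNIV f"
  shows "integrable lborel (\<lambda>z. k z * f z)"
  using mollifierD(2,6)[OF assms(1)] assms(2)
  by (intro integrable_continuous_bounded_support continuous_on_mult) (auto elim: bounded_subset)

lemma continuous_on_reflect:
  fixes f :: "'a::euclidean_space \<Rightarrow> real"
  assumes "continuous_on UNIV f"
  shows "continuous_on UNIV (\<lambda>z. f (x - z))"
  by (rule continuous_on_compose2[OF assms]) (auto intro!: continuous_intros)

lemma abs_convolution_diff_le:
  fixes f k :: "'a::euclidean_space \<Rightarrow> real"
  assumes k: "mollifier r k" and f: "continuous_on UNIV f"
    and near: "\<And>z. norm z < r \<Longrightarrow> \<bar>f (x - z) - f x\<bar> \<le> e"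
  shows "\<bar>convolution k f x - f x\<bar> \<le> e"
proof -
  note int_kf = integrable_mollifier_mult[OF k continuous_on_reflect[OF f, of x]]
  have "convolution k f x - f x = (\<integral>z. k z * (f (x - z) - f x) \<partial>lborel)"
    using int_kf mollifierD(5,8)[OF k] by (simp add: convolution_def right_diff_distrib)
  also have "\<bar>\<dots>\<bar> \<le> (\<integral>z. \<bar>k z * (f (x - z) - f x)\<bar> \<partial>lborel)"
    by (rule integral_abs_bound)
  also have "\<dots> \<le> (\<integral>z. k z * e \<partial>lborel)"
  proof (rule integral_mono)
    show "integrable lborel (\<lambda>z. \<bar>k z * (f (x - z) - f x)\<bar>)"
      using int_kf mollifierD(8)[OF k] by (simp add: right_diff_distrib)
    show "\<bar>k z * (f (x - z) - f x)\<bar> \<le> k z * e" for z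
      using near[of z] mollifierD(3,4)[OF k, of z]
      by (cases "k z = 0") (auto simp: abs_mult intro: mult_left_mono)
  qed (use mollifierD(8)[OF k] in simp)
  finally show ?thesis
    using mollifierD(5)[OF k] by simp
qed

lemma gagliardo_enn_translate:
  fixes f :: "'a::euclidean_space \<Rightarrow> real"
  assumes "f \<in> borel_measurable borel"
  shows "gagliardo_enn s p (\<lambda>x. f (x - z)) = gagliardo_enn s p f"
  using gagliardo_enn_similarity[OF assms similarity_translate[of "- z"], of s p] by simp

lemma abs_increment_convolution_powr_le:
  fixes f k :: "'a::euclidean_space \<Rightarrow> real"
  assumes p: "1 < p" and k: "mollifier r k" and f: "continuous_on UNIV f"
  shows "ennreal (\<bar>increment (convolution k f) w\<bar> powr p)
    \<le> (\<integral>\<^sup>+z. ennreal (k z) * ennreal (\<bar>increment (\<lambda>x. f (x - z)) w\<bar> powr p) \<partial>lborel)"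
proof -
  define d where "d z = increment (\<lambda>x. f (x - z)) w" for z
  have cont: "continuous_on UNIV (\<lambda>z. f (x - z))" for x
    using f by (rule continuous_on_reflect)
  then have "continuous_on UNIV (\<lambda>z. \<bar>d z\<bar> powr p)"
    using p unfolding d_def increment_def
    by (intro continuous_on_powr' continuous_on_rabs continuous_on_diff continuous_on_const) auto
  then have int_powr: "integrable lborel (\<lambda>z. k z * \<bar>d z\<bar> powr p)"
    by (rule integrable_mollifier_mult[OF k])
  have int_d: "integrable lborel (\<lambda>z. k z * d z)"
    unfolding d_def increment_def by (intro integrable_mollifier_mult[OF k] continuous_on_diff cont)
  have "increment (convolution k f) w = (\<integral>z. k z * d z \<partial>lborel)"
    using integrable_mollifier_mult[OF k cont]
    by (simp add: increment_def convolution_def d_def right_diff_distrib)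
  then have "\<bar>increment (convolution k f) w\<bar> powr p \<le> (\<integral>z. k z * \<bar>d z\<bar> powr p \<partial>lborel)"
    using abs_powr_integral_le[OF p mollifierD(3,8,5)[OF k] int_d int_powr] by simp
  then have "ennreal (\<bar>increment (convolution k f) w\<bar> powr p)
      \<le> ennreal (\<integral>z. k z * \<bar>d z\<bar> powr p \<partial>lborel)"
    by (rule ennreal_leI)
  also have "\<dots> = (\<integral>\<^sup>+z. ennreal (k z * \<bar>d z\<bar> powr p) \<partial>lborel)"
    using mollifierD(3)[OF k] by (intro nn_integral_eq_integral[symmetric] int_powr) simp
  finally show ?thesis
    by (simp add: d_def ennreal_mult mollifierD(3)[OF k])
qed

lemma gagliardo_enn_convolution_le:
  fixes f k :: "'a::euclidean_space \<Rightarrow> real"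
  assumes p: "1 < p" and k: "mollifier r k" and f: "continuous_on UNIV f"
  shows "gagliardo_enn s p (convolution k f) \<le> gagliardo_enn s p f"
proof -
  let ?\<mu> = "gagliardo_measure s p :: ('a \<times> 'a) measure"
  have [measurable]: "f \<in> borel_measurable borel" "k \<in> borel_measurable borel"
    using f mollifierD(2)[OF k] by (auto intro: borel_measurable_continuous_onI)
  have [measurable]: "convolution k f \<in> borel_measurable borel"
    unfolding convolution_def by measurable
  interpret \<mu>: sigma_finite_measure ?\<mu>
    by (rule sigma_finite_gagliardo_measure)
  interpret pair_sigma_finite "lborel :: 'a measure" ?\<mu> ..
  let ?d = "\<lambda>z w. ennreal (\<bar>increment (\<lambda>x. f (x - z)) w\<bar> powr p)"
  have "gagliardo_enn s p (convolution k f)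
      = (\<integral>\<^sup>+w. ennreal (\<bar>increment (convolution k f) w\<bar> powr p) \<partial>?\<mu>)"
    by (simp add: gagliardo_enn_eq_nn_integral)
  also have "\<dots> \<le> (\<integral>\<^sup>+w. \<integral>\<^sup>+z. ennreal (k z) * ?d z w \<partial>lborel \<partial>?\<mu>)"
    by (intro nn_integral_mono abs_increment_convolution_powr_le[OF p k f])
  also have "\<dots> = (\<integral>\<^sup>+z. \<integral>\<^sup>+w. ennreal (k z) * ?d z w \<partial>?\<mu> \<partial>lborel)"
    unfolding increment_def by (intro Fubini') measurable
  also have "\<dots> = (\<integral>\<^sup>+z. ennreal (k z) * gagliardo_enn s p (\<lambda>x. f (x - z)) \<partial>lborel)"
    by (simp add: gagliardo_enn_eq_nn_integral nn_integral_cmult)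
  also have "\<dots> = (\<integral>\<^sup>+z. ennreal (k z) \<partial>lborel) * gagliardo_enn s p f"
    by (simp add: gagliardo_enn_translate nn_integral_multc)
  also have "(\<integral>\<^sup>+z. ennreal (k z) \<partial>lborel) = 1"
    using nn_integral_eq_integral[OF mollifierD(8)[OF k]] mollifierD(3,5)[OF k] by simp
  finally show ?thesis
    by simp
qed

lemma test_fun_approximation:
  fixes f :: "'a::euclidean_space \<Rightarrow> real"
  assumes p: "1 < p" and f: "f \<in> Wsp s p" "bounded {x. f x \<noteq> 0}" and \<alpha>: "0 < alpha_sp s p DIM('a)"
    and e: "0 < e"
  shows "\<exists>g. test_fun g \<and> (\<forall>x. \<bar>g x - f x\<bar> \<le> e) \<and> gagliardo_enn s p g \<le> gagliardo_enn s p f"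
proof -
  let ?\<alpha> = "alpha_sp s p DIM('a)"
  obtain C where C: "0 \<le> C" "\<And>x y. \<bar>f x - f y\<bar> \<le> C * norm (x - y) powr ?\<alpha>"
    using holder_boundedE[OF WspD(3)[OF f(1)]] by blast
  define r where "r = (e / (C + 1)) powr (1 / ?\<alpha>)"
  have "0 < r"
    using e C(1) by (simp add: r_def)
  then obtain k :: "'a \<Rightarrow> real" where k: "mollifier r k"
    using mollifier_exists by blast
  have near: "\<bar>f (x - z) - f x\<bar> \<le> e" if "norm z < r" for x z
  proof -
    have "norm z powr ?\<alpha> \<le> r powr ?\<alpha>"
      using that \<alpha> by (intro powr_mono2) auto
    also have "\<dots> = e / (C + 1)"
      using \<alpha> e C(1) by (simp add: r_def powr_powr)
    finally have "C * norm z powr ?\<alpha> \<le> C * (e / (C + 1))"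
      using C(1) by (rule mult_left_mono)
    also have "\<dots> \<le> e"
      using e C(1) by (simp add: field_simps)
    finally show ?thesis
      using C(2)[of "x - z" x] by simp
  qed
  have cont: "continuous_on UNIV f"
    using f(1) by (rule WspD)
  have "test_fun (convolution k f)"
    by (rule test_fun_convolution[OF mollifierD(7)[OF k] cont f(2)])
  moreover have "\<bar>convolution k f x - f x\<bar> \<le> e" for x
    by (rule abs_convolution_diff_le[OF k cont]) (rule near)
  moreover have "gagliardo_enn s p (convolution k f) \<le> gagliardo_enn s p f"
    by (rule gagliardo_enn_convolution_le[OF p k cont])
  ultimately show ?thesis
    by blast
qed

section \<open>Hoelder quotients\<close>

definition holder_quot :: "real \<Rightarrow> ('a::euclidean_space \<Rightarrow> real) \<Rightarrow> 'a \<Rightarrow> 'a \<Rightarrow> real" where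
  "holder_quot \<alpha> f x y = \<bar>f x - f y\<bar> / norm (x - y) powr \<alpha>"

lemma holder_quot_nonneg [simp]: "0 \<le> holder_quot \<alpha> f x y"
  by (simp add: holder_quot_def)

lemma holder_quot_same [simp]: "holder_quot \<alpha> f x x = 0"
  by (simp add: holder_quot_def)

lemma holder_quot_eq_0_iff: "holder_quot \<alpha> f x y = 0 \<longleftrightarrow> f x = f y"
  by (auto simp: holder_quot_def)

lemma holder_quot_powr:
  fixes f :: "'a::euclidean_space \<Rightarrow> real"
  assumes "p \<noteq> 0"
  shows "holder_quot (alpha_sp s p DIM('a)) f x y powr p
    = \<bar>f x - f y\<bar> powr p / norm (x - y) powr (s * p - real DIM('a))"
  using assms by (simp add: holder_quot_def powr_divide powr_powr alpha_sp_times_p)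

lemma holder_quot_divide:
  "holder_quot \<alpha> (\<lambda>x. f x / c) x y = holder_quot \<alpha> f x y / \<bar>c\<bar>"
  by (simp add: holder_quot_def abs_divide flip: diff_divide_distrib)

lemma holder_quot_le_holder_sn:
  fixes f :: "'a::euclidean_space \<Rightarrow> real"
  assumes "holder_bounded \<alpha> f"
  shows "holder_quot \<alpha> f x y \<le> holder_sn \<alpha> f"
proof -
  obtain C where "\<And>x y. x \<noteq> y \<Longrightarrow> holder_quot \<alpha> f x y \<le> C"
    using assms unfolding holder_bounded_def holder_quot_def by blast
  then have "bdd_above ((\<lambda>z. holder_quot \<alpha> f (fst z) (snd z)) ` {z. fst z \<noteq> snd z})"
    by (intro bdd_aboveI2[where M = C]) auto
  then have le: "holder_quot \<alpha> f x y \<le> holder_sn \<alpha> f" if "x \<noteq> y" for x y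
    using cSUP_upper[of "(x, y)" "{z. fst z \<noteq> snd z}" "\<lambda>z. holder_quot \<alpha> f (fst z) (snd z)"] that
    by (simp add: holder_sn_def holder_quot_def)
  obtain b :: 'a where "b \<in> Basis"
    using nonempty_Basis by blast
  then have "holder_quot \<alpha> f b 0 \<le> holder_sn \<alpha> f"
    by (intro le) auto
  then have "0 \<le> holder_sn \<alpha> f"
    using holder_quot_nonneg[of \<alpha> f b 0] by linarith
  then show ?thesis
    using le by (cases "x = y") auto
qed

lemma holder_sn_le:
  fixes f :: "'a::euclidean_space \<Rightarrow> real"
  assumes "\<And>x y. holder_quot \<alpha> f x y \<le> B"
  shows "holder_sn \<alpha> f \<le> B"
  unfolding holder_sn_def
proof (rule cSUP_least)
  obtain b :: 'a where "b \<in> Basis"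
    using nonempty_Basis by blast
  then have "(b, 0) \<in> {z :: 'a \<times> 'a. fst z \<noteq> snd z}"
    by auto
  then show "{z :: 'a \<times> 'a. fst z \<noteq> snd z} \<noteq> {}"
    by blast
qed (use assms in \<open>auto simp: holder_quot_def\<close>)

lemma holder_sn_nonneg: "holder_bounded \<alpha> f \<Longrightarrow> 0 \<le> holder_sn \<alpha> f"
  using holder_quot_le_holder_sn[of \<alpha> f undefined undefined] by simp

lemma holder_sn_pos:
  assumes "holder_bounded \<alpha> f" "f x \<noteq> f y"
  shows "0 < holder_sn \<alpha> f"
  using holder_quot_le_holder_sn[OF assms(1), of x y] holder_quot_nonneg[of \<alpha> f x y]
    holder_quot_eq_0_iff[of \<alpha> f x y] assms(2) by linarith

lemma holder_sn_divide:
  fixes f :: "'a::euclidean_space \<Rightarrow> real"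
  assumes f: "holder_bounded \<alpha> f" and c: "0 < c"
  shows "holder_sn \<alpha> (\<lambda>x. f x / c) = holder_sn \<alpha> f / c"
proof (rule antisym)
  have le: "holder_quot \<alpha> (\<lambda>x. f x / c) x y \<le> holder_sn \<alpha> f / c" for x y
    using holder_quot_le_holder_sn[OF f] c by (simp add: holder_quot_divide divide_right_mono)
  then show "holder_sn \<alpha> (\<lambda>x. f x / c) \<le> holder_sn \<alpha> f / c"
    by (rule holder_sn_le)
  have "holder_bounded \<alpha> (\<lambda>x. f x / c)"
    using le unfolding holder_bounded_def holder_quot_def by blast
  then have "holder_quot \<alpha> f x y \<le> c * holder_sn \<alpha> (\<lambda>x. f x / c)" for x y
    using holder_quot_le_holder_sn[of \<alpha> "\<lambda>x. f x / c" x y] c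
    by (simp add: holder_quot_divide pos_divide_le_eq mult.commute)
  then have "holder_sn \<alpha> f \<le> c * holder_sn \<alpha> (\<lambda>x. f x / c)"
    by (rule holder_sn_le)
  then show "holder_sn \<alpha> f / c \<le> holder_sn \<alpha> (\<lambda>x. f x / c)"
    using c by (simp add: pos_divide_le_eq mult.commute)
qed

lemma holder_sn_powr_le:
  assumes f: "holder_bounded \<alpha> f" and "0 < p" "0 < c"
    and le: "\<And>x y. c * holder_quot \<alpha> f x y powr p \<le> B"
  shows "c * holder_sn \<alpha> f powr p \<le> B"
proof -
  have "0 \<le> B / c"
    using le[of undefined undefined] assms(2,3) by simp
  have "holder_quot \<alpha> f x y \<le> (B / c) powr (1 / p)" for x y
  proof -
    have "holder_quot \<alpha> f x y powr p \<le> B / c"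
      using le[of x y] \<open>0 < c\<close> by (simp add: pos_le_divide_eq mult.commute)
    then have "(holder_quot \<alpha> f x y powr p) powr (1 / p) \<le> (B / c) powr (1 / p)"
      using \<open>0 < p\<close> by (intro powr_mono2) auto
    then show ?thesis
      using \<open>0 < p\<close> by (simp add: powr_powr)
  qed
  then have "holder_sn \<alpha> f powr p \<le> ((B / c) powr (1 / p)) powr p"
    using \<open>0 < p\<close> holder_sn_nonneg[OF f] by (intro powr_mono2 holder_sn_le) auto
  also have "\<dots> = B / c"
    using \<open>0 < p\<close> \<open>0 \<le> B / c\<close> by (simp add: powr_powr flip: abs_divide)
  finally show ?thesis
    using \<open>0 < c\<close> by (simp add: pos_le_divide_eq mult.commute)
qed

section \<open>The Morrey inequality\<close>

context
  fixes s p :: real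
  assumes sp: "s < 1" "1 < p" "real DIM('a::euclidean_space) < s * p"
begin

lemma test_fun_normalize:
  fixes g :: "'a \<Rightarrow> real"
  assumes g: "test_fun g" "g x \<noteq> g y"
  defines "c \<equiv> holder_sn (alpha_sp s p DIM('a)) g"
  shows "0 < c" "test_fun (\<lambda>x. g x / c)" "holder_sn (alpha_sp s p DIM('a)) (\<lambda>x. g x / c) = 1"
    "gagliardo_p s p (\<lambda>x. g x / c) = gagliardo_p s p g / c powr p"
proof -
  have W: "g \<in> Wsp s p"
    using sp g(1) by (intro test_fun_in_Wsp) auto
  show "0 < c"
    unfolding c_def by (rule holder_sn_pos[OF WspD(3)[OF W] g(2)])
  then show "holder_sn (alpha_sp s p DIM('a)) (\<lambda>x. g x / c) = 1"
    using holder_sn_divide[OF WspD(3)[OF W] \<open>0 < c\<close>] by (simp add: c_def)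
  show "test_fun (\<lambda>x. g x / c)"
    using g(1) by (rule test_fun_divide)
  show "gagliardo_p s p (\<lambda>x. g x / c) = gagliardo_p s p g / c powr p"
    using gagliardo_p_affine[OF WspD(2)[OF W], of s p "1 / c" 0] \<open>0 < c\<close> by (simp add: powr_divide)
qed

lemma ex_normalized_test_fun:
  "\<exists>\<phi> :: 'a \<Rightarrow> real. test_fun \<phi> \<and> holder_sn (alpha_sp s p DIM('a)) \<phi> = 1"
proof -
  obtain k :: "'a \<Rightarrow> real" where k: "mollifier 1 k"
    using mollifier_exists[of 1] by auto
  obtain b :: 'a where "b \<in> Basis"
    using nonempty_Basis by blast
  then have "k b = 0"
    using mollifierD(4)[OF k, of b] by auto
  moreover obtain z where "k z \<noteq> 0"
    using mollifierD(5)[OF k] by (cases "\<forall>z. k z = 0") auto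
  ultimately have "k z \<noteq> k b"
    by simp
  then show ?thesis
    using test_fun_normalize(2,3)[OF mollifierD(7)[OF k]] by blast
qed

lemma m_sp_le:
  fixes \<phi> :: "'a \<Rightarrow> real"
  assumes "test_fun \<phi>" "holder_sn (alpha_sp s p DIM('a)) \<phi> = 1"
  shows "m_sp s p TYPE('a) \<le> gagliardo_p s p \<phi>"
  unfolding m_sp_def using assms by (intro cInf_lower bdd_belowI[of _ 0]) auto

lemma m_sp_greatest:
  assumes "\<And>\<phi> :: 'a \<Rightarrow> real.
    test_fun \<phi> \<Longrightarrow> holder_sn (alpha_sp s p DIM('a)) \<phi> = 1 \<Longrightarrow> c \<le> gagliardo_p s p \<phi>"
  shows "c \<le> m_sp s p TYPE('a)"
  unfolding m_sp_def using ex_normalized_test_fun assms by (intro cInf_greatest) auto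

lemma morrey_test_fun:
  fixes g :: "'a \<Rightarrow> real"
  assumes g: "test_fun g"
  shows "m_sp s p TYPE('a) * holder_quot (alpha_sp s p DIM('a)) g x y powr p \<le> gagliardo_p s p g"
proof (cases "g x = g y")
  case False
  let ?H = "holder_sn (alpha_sp s p DIM('a)) g"
  note normalized = test_fun_normalize[OF g False]
  have "holder_bounded (alpha_sp s p DIM('a)) g"
    using sp g by (intro WspD(3) test_fun_in_Wsp) auto
  then have "m_sp s p TYPE('a) * holder_quot (alpha_sp s p DIM('a)) g x y powr p
      \<le> m_sp s p TYPE('a) * ?H powr p"
    using sp(2) by (intro mult_left_mono powr_mono2 holder_quot_le_holder_sn m_sp_greatest) auto
  also have "\<dots> \<le> gagliardo_p s p g"
    using m_sp_le[OF normalized(2,3)] normalized(1) by (simp add: normalized(4) pos_le_divide_eq)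
  finally show ?thesis .
qed (use holder_quot_eq_0_iff[of _ g x y] in simp)

lemma morrey_bounded_support:
  fixes f :: "'a \<Rightarrow> real"
  assumes f: "f \<in> Wsp s p" "bounded {x. f x \<noteq> 0}"
  shows "m_sp s p TYPE('a) * holder_quot (alpha_sp s p DIM('a)) f x y powr p \<le> gagliardo_p s p f"
proof (cases "x = y")
  case False
  let ?\<alpha> = "alpha_sp s p DIM('a)"
  have "\<exists>g. test_fun g \<and> (\<forall>x. \<bar>g x - f x\<bar> \<le> inverse (real (Suc n)))
      \<and> gagliardo_enn s p g \<le> gagliardo_enn s p f" for n
    using sp f by (intro test_fun_approximation alpha_sp_pos) auto
  then obtain g where g: "\<And>n. test_fun (g n)" "\<And>n x. \<bar>g n x - f x\<bar> \<le> inverse (real (Suc n))"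
    "\<And>n. gagliardo_enn s p (g n) \<le> gagliardo_enn s p f"
    by metis
  have "(\<lambda>n. g n x) \<longlonglongrightarrow> f x" for x
  proof -
    have "(\<lambda>n. g n x - f x) \<longlonglongrightarrow> 0"
      by (rule Lim_null_comparison[OF _ LIMSEQ_inverse_real_of_nat]) (use g(2) in auto)
    then show ?thesis
      by (simp add: LIM_zero_iff)
  qed
  then have "(\<lambda>n. m_sp s p TYPE('a) * holder_quot ?\<alpha> (g n) x y powr p)
      \<longlonglongrightarrow> m_sp s p TYPE('a) * holder_quot ?\<alpha> f x y powr p"
    unfolding holder_quot_def using sp(2) False
    by (intro tendsto_mult tendsto_const tendsto_powr' tendsto_divide tendsto_rabs tendsto_diff)
      auto
  moreover have "m_sp s p TYPE('a) * holder_quot ?\<alpha> (g n) x y powr p \<le> gagliardo_p s p f" for n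
  proof -
    have "gagliardo_p s p (g n) \<le> gagliardo_p s p f"
      unfolding gagliardo_p_def using g(3)[of n] f(1) by (intro enn2real_mono) (auto simp: Wsp_def)
    then show ?thesis
      using morrey_test_fun[OF g(1), of n x y] by linarith
  qed
  ultimately show ?thesis
    by (intro LIMSEQ_le_const2) auto
qed simp

lemma small_energy_cutoff_exists:
  assumes "0 \<le> M" "0 < e"
  shows "\<exists>\<psi>\<in>Wsp s p. bounded {x :: 'a. \<psi> x \<noteq> 0} \<and> (\<forall>x. 0 \<le> \<psi> x) \<and> (\<forall>x. norm x \<le> R \<longrightarrow> M \<le> \<psi> x)
    \<and> gagliardo_p s p \<psi> < e"
proof -
  define \<eta> :: "'a \<Rightarrow> real" where "\<eta> = (\<lambda>x. M * max 0 (2 - norm x))"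
  have \<eta>: "\<eta> \<in> Wsp s p"
    using Wsp_affine[OF hat_in_Wsp[of s p 2 "0::'a"], of M 0] sp by (simp add: \<eta>_def)
  have "eventually (\<lambda>t. gagliardo_p s p (\<lambda>x. \<eta> (t *\<^sub>R x)) < e) (at_right 0)"
    using gagliardo_p_dilate_tendsto_0[OF WspD(2)[OF \<eta>] sp(3)] \<open>0 < e\<close> by (rule order_tendstoD)
  moreover have "eventually (\<lambda>t. t < 1 / (\<bar>R\<bar> + 1)) (at_right (0::real))"
    using tendsto_ident_at by (rule order_tendstoD) auto
  ultimately have "eventually (\<lambda>t. 0 < t \<and> t < 1 / (\<bar>R\<bar> + 1)
      \<and> gagliardo_p s p (\<lambda>x. \<eta> (t *\<^sub>R x)) < e) (at_right 0)"
    using eventually_at_right_less by eventually_elim simp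
  then obtain t where t: "0 < t" "t < 1 / (\<bar>R\<bar> + 1)" "gagliardo_p s p (\<lambda>x. \<eta> (t *\<^sub>R x)) < e"
    using eventually_happens' trivial_limit_at_right_real by blast
  have "M \<le> \<eta> (t *\<^sub>R x)" if "norm x \<le> R" for x
  proof -
    have "t * norm x \<le> t * (\<bar>R\<bar> + 1)"
      using t(1) that by (intro mult_left_mono) auto
    also have "\<dots> < 1"
      using t(2) by (simp add: pos_less_divide_eq)
    finally have "M * 1 \<le> M * max 0 (2 - norm (t *\<^sub>R x))"
      using t(1) \<open>0 \<le> M\<close> by (intro mult_left_mono) simp_all
    then show ?thesis
      by (simp add: \<eta>_def)
  qed
  moreover have "\<eta> (t *\<^sub>R x) = 0" if "x \<notin> ball 0 (2 / t)" for x
    using that t(1) by (simp add: \<eta>_def pos_less_divide_eq max_def mult.commute)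
  then have "bounded {x. \<eta> (t *\<^sub>R x) \<noteq> 0}"
    by (intro bounded_subset[OF bounded_ball[of 0 "2 / t"]]) blast
  moreover have "0 \<le> \<eta> (t *\<^sub>R x)" for x
    using \<open>0 \<le> M\<close> by (simp add: \<eta>_def)
  ultimately show ?thesis
    using Wsp_dilate[OF \<eta> t(1)] t(3) by (intro bexI[of _ "\<lambda>x. \<eta> (t *\<^sub>R x)"]) blast+
qed

lemma Wsp_cutoff:
  fixes f :: "'a \<Rightarrow> real"
  assumes f: "f \<in> Wsp s p" "\<And>x. 0 \<le> f x" "\<And>x. f x \<le> M" and "0 < e"
  shows "\<exists>g\<in>Wsp s p. bounded {x. g x \<noteq> 0} \<and> (\<forall>x. norm x \<le> R \<longrightarrow> g x = f x)
    \<and> gagliardo_p s p g \<le> gagliardo_p s p f + e"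
proof -
  have "0 \<le> M"
    using f(2,3) order.trans by blast
  then obtain \<psi> :: "'a \<Rightarrow> real" where \<psi>: "\<psi> \<in> Wsp s p" "bounded {x. \<psi> x \<noteq> 0}" "\<And>x. 0 \<le> \<psi> x"
    "\<And>x. norm x \<le> R \<Longrightarrow> M \<le> \<psi> x" "gagliardo_p s p \<psi> < e"
    using small_energy_cutoff_exists[of M e R] \<open>0 < e\<close> by blast
  define g where "g x = min (f x) (\<psi> x)" for x
  have "g x = f x" if "norm x \<le> R" for x
    using f(3)[of x] \<psi>(4)[OF that] by (simp add: g_def)
  moreover have "bounded {x. g x \<noteq> 0}"
    using \<psi>(2) by (rule bounded_subset) (use f(2) in \<open>auto simp: g_def min_def intro: antisym\<close>)
  moreover have "g \<in> Wsp s p" "gagliardo_p s p g \<le> gagliardo_p s p f + gagliardo_p s p \<psi>"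
    using sp(2) f(1) \<psi>(1) unfolding g_def by (auto intro: Wsp_min gagliardo_p_min_le)
  ultimately show ?thesis
    using \<psi>(5) by force
qed

lemma morrey_inequality:
  fixes f :: "'a \<Rightarrow> real"
  assumes f: "f \<in> Wsp s p"
  shows "m_sp s p TYPE('a) * holder_quot (alpha_sp s p DIM('a)) f x y powr p \<le> gagliardo_p s p f"
proof (rule field_le_epsilon)
  fix e :: real
  assume "0 < e"
  define M where "M = \<bar>f x\<bar> + \<bar>f y\<bar>"
  define h where "h z = max 0 (min (2 * M) (f z + M))" for z
  have "continuous_on UNIV h"
    unfolding h_def by (intro continuous_intros continuous_on_max continuous_on_min WspD(1)[OF f])
  moreover have "\<bar>h z - h w\<bar> \<le> \<bar>f z - f w\<bar>" for z w
    by (auto simp: h_def)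
  ultimately have h: "h \<in> Wsp s p" "gagliardo_p s p h \<le> gagliardo_p s p f"
    using Wsp_mono[of p h f s] gagliardo_p_mono[of p h f s] f sp(2) by auto
  have "\<exists>g\<in>Wsp s p. bounded {z. g z \<noteq> 0} \<and> (\<forall>z. norm z \<le> max (norm x) (norm y) \<longrightarrow> g z = h z)
      \<and> gagliardo_p s p g \<le> gagliardo_p s p h + e"
    by (rule Wsp_cutoff[OF h(1), where M = "2 * M"]) (use \<open>0 < e\<close> in \<open>auto simp: h_def M_def\<close>)
  then obtain g where g: "g \<in> Wsp s p" "bounded {z. g z \<noteq> 0}" "g x = h x" "g y = h y"
    "gagliardo_p s p g \<le> gagliardo_p s p h + e"
    by auto
  have "h x = f x + M" "h y = f y + M"
    by (auto simp: h_def M_def)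
  then have "holder_quot (alpha_sp s p DIM('a)) f x y = holder_quot (alpha_sp s p DIM('a)) g x y"
    by (simp add: holder_quot_def g(3,4))
  then show "m_sp s p TYPE('a) * holder_quot (alpha_sp s p DIM('a)) f x y powr p
      \<le> gagliardo_p s p f + e"
    using morrey_bounded_support[OF g(1,2), of x y] g(5) h(2) by simp
qed

section \<open>Extremals and two-point minimizers\<close>

text \<open>Transplant \<open>f\<close> by the similarity that maps \<open>(x0, y0)\<close> to \<open>(x, y)\<close>, and rescale it so that
  it competes with \<open>u\<close>.\<close>

lemma two_point_minimizer_quot_le:
  fixes u f :: "'a \<Rightarrow> real"
  assumes u: "two_point_minimizer s p x0 y0 u" "u x0 \<noteq> u y0" and f: "f \<in> Wsp s p"
  shows "gagliardo_p s p u * holder_quot (alpha_sp s p DIM('a)) f x y powr p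
      \<le> gagliardo_p s p f * holder_quot (alpha_sp s p DIM('a)) u x0 y0 powr p"
proof (cases "f x = f y")
  case False
  let ?d = "s * p - real DIM('a)"
  have ne: "x0 \<noteq> y0" "x \<noteq> y"
    using u(2) False by auto
  define r where "r = norm (x - y) / norm (x0 - y0)"
  obtain S where S: "similarity r S" "S x0 = x" "S y0 = y"
    using similarity_exists[OF ne] unfolding r_def by blast
  define c where "c = (u x0 - u y0) / (f x - f y)"
  define d where "d = u y0 - c * f y"
  have fS: "(\<lambda>z. f (S z)) \<in> Wsp s p"
    by (rule Wsp_similarity[OF f S(1)])
  have "c * (f x - f y) = u x0 - u y0"
    using False by (simp add: c_def)
  then have "gagliardo_p s p u \<le> gagliardo_p s p (\<lambda>z. c * f (S z) + d)"
    by (intro two_point_minimizerD(2)[OF u(1)] Wsp_affine fS) (simp_all add: S d_def algebra_simps)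
  also have "\<dots> = \<bar>c\<bar> powr p * r powr ?d * gagliardo_p s p f"
    by (simp add: gagliardo_p_affine[OF WspD(2)[OF fS]]
        gagliardo_p_similarity[OF WspD(2)[OF f] S(1)])
  also have "\<bar>c\<bar> powr p = \<bar>u x0 - u y0\<bar> powr p / \<bar>f x - f y\<bar> powr p"
    by (simp add: c_def abs_divide powr_divide)
  also have "r powr ?d = norm (x - y) powr ?d / norm (x0 - y0) powr ?d"
    by (simp add: r_def powr_divide)
  finally show ?thesis
    using False ne sp(2) by (simp add: holder_quot_powr field_simps)
qed (use holder_quot_eq_0_iff[of _ f x y] in simp)

lemma two_point_minimizer_holder_sn:
  fixes u f :: "'a \<Rightarrow> real"
  assumes u: "two_point_minimizer s p x0 y0 u" "u x0 \<noteq> u y0"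
  shows "0 < gagliardo_p s p u"
    and "f \<in> Wsp s p \<Longrightarrow> gagliardo_p s p u * holder_sn (alpha_sp s p DIM('a)) f powr p
      \<le> gagliardo_p s p f * holder_quot (alpha_sp s p DIM('a)) u x0 y0 powr p"
    and "holder_sn (alpha_sp s p DIM('a)) u = holder_quot (alpha_sp s p DIM('a)) u x0 y0"
proof -
  note W = two_point_minimizerD(1)[OF u(1)]
  have "gagliardo_p s p u \<noteq> 0"
    using gagliardo_p_eq_0_iff[OF sp(2) W] u(2) by blast
  then show pos: "0 < gagliardo_p s p u"
    using gagliardo_p_nonneg[of s p u] by linarith
  show le: "gagliardo_p s p u * holder_sn (alpha_sp s p DIM('a)) f powr p
      \<le> gagliardo_p s p f * holder_quot (alpha_sp s p DIM('a)) u x0 y0 powr p"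
    if "f \<in> Wsp s p" for f :: "'a \<Rightarrow> real"
    using sp(2) two_point_minimizer_quot_le[OF u that]
    by (intro holder_sn_powr_le WspD(3)[OF that] pos) auto
  show "holder_sn (alpha_sp s p DIM('a)) u = holder_quot (alpha_sp s p DIM('a)) u x0 y0"
  proof (rule antisym)
    show "holder_quot (alpha_sp s p DIM('a)) u x0 y0 \<le> holder_sn (alpha_sp s p DIM('a)) u"
      by (rule holder_quot_le_holder_sn[OF WspD(3)[OF W]])
    show "holder_sn (alpha_sp s p DIM('a)) u \<le> holder_quot (alpha_sp s p DIM('a)) u x0 y0"
    proof (rule ccontr)
      assume "\<not> holder_sn (alpha_sp s p DIM('a)) u \<le> holder_quot (alpha_sp s p DIM('a)) u x0 y0"
      then have "holder_quot (alpha_sp s p DIM('a)) u x0 y0 powr p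
          < holder_sn (alpha_sp s p DIM('a)) u powr p"
        using sp(2) by (intro powr_less_mono2) auto
      then show False
        using le[OF W] pos by simp
    qed
  qed
qed

lemma two_point_minimizer_of_extremal:
  fixes u :: "'a \<Rightarrow> real"
  assumes ext: "extremal s p u"
    and attained: "holder_sn (alpha_sp s p DIM('a)) u = holder_quot (alpha_sp s p DIM('a)) u x0 y0"
  shows "two_point_minimizer s p x0 y0 u" "u x0 \<noteq> u y0"
proof -
  let ?\<alpha> = "alpha_sp s p DIM('a)"
  obtain x y where u: "u \<in> Wsp s p" "u x \<noteq> u y"
    and energy: "gagliardo_p s p u = m_sp s p TYPE('a) * holder_quot ?\<alpha> u x0 y0 powr p"
    using ext attained unfolding extremal_def by auto
  have "gagliardo_p s p u \<le> gagliardo_p s p f" if "f \<in> Wsp s p" "f x0 = u x0" "f y0 = u y0" for f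
    using morrey_inequality[OF that(1), of x0 y0] by (simp add: energy holder_quot_def that)
  then show "two_point_minimizer s p x0 y0 u"
    using u(1) by (simp add: two_point_minimizer_def)
  show "u x0 \<noteq> u y0"
    using holder_sn_pos[OF WspD(3)[OF u(1)] u(2)] attained holder_quot_eq_0_iff[of ?\<alpha> u x0 y0]
    by auto
qed

lemma extremal_of_two_point_minimizer:
  fixes u :: "'a \<Rightarrow> real"
  assumes u: "two_point_minimizer s p x0 y0 u" "u x0 \<noteq> u y0"
  shows "extremal s p u"
proof -
  let ?\<alpha> = "alpha_sp s p DIM('a)" and ?H = "holder_quot (alpha_sp s p DIM('a)) u x0 y0"
  note W = two_point_minimizerD(1)[OF u(1)]
  have "0 < ?H"
    using u(2) holder_quot_nonneg[of ?\<alpha> u x0 y0] holder_quot_eq_0_iff[of ?\<alpha> u x0 y0] by linarith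
  have "gagliardo_p s p u / ?H powr p \<le> gagliardo_p s p \<phi>"
    if "test_fun \<phi>" "holder_sn ?\<alpha> \<phi> = 1" for \<phi> :: "'a \<Rightarrow> real"
  proof -
    have "\<phi> \<in> Wsp s p"
      using sp that(1) by (intro test_fun_in_Wsp) auto
    then show ?thesis
      using two_point_minimizer_holder_sn(2)[OF u, of \<phi>] that(2) \<open>0 < ?H\<close>
      by (simp add: pos_divide_le_eq)
  qed
  then have "gagliardo_p s p u \<le> m_sp s p TYPE('a) * ?H powr p"
    using m_sp_greatest[of "gagliardo_p s p u / ?H powr p"] \<open>0 < ?H\<close> by (simp add: pos_divide_le_eq)
  then have "gagliardo_p s p u = m_sp s p TYPE('a) * holder_sn ?\<alpha> u powr p"
    using morrey_inequality[OF W, of x0 y0] by (simp add: two_point_minimizer_holder_sn(3)[OF u])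
  then show ?thesis
    using u(2) W unfolding extremal_def by blast
qed

lemma extremal_iff_two_point_minimizer:
  fixes u :: "'a \<Rightarrow> real"
  shows "extremal s p u
      \<and> holder_sn (alpha_sp s p DIM('a)) u = holder_quot (alpha_sp s p DIM('a)) u x0 y0
    \<longleftrightarrow> two_point_minimizer s p x0 y0 u \<and> u x0 \<noteq> u y0"
  using two_point_minimizer_of_extremal extremal_of_two_point_minimizer
    two_point_minimizer_holder_sn(3) by blast

lemma dipole_iff_two_point_minimizer:
  fixes u :: "'a \<Rightarrow> real"
  assumes "x0 \<noteq> y0"
  shows "u \<in> Wsp s p \<and> (\<exists>c. c \<noteq> 0 \<and> weak_dipole_solution s p u c x0 y0)
    \<longleftrightarrow> two_point_minimizer s p x0 y0 u \<and> u x0 \<noteq> u y0"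
    (is "?dipole \<longleftrightarrow> ?min")
proof
  assume ?dipole
  then obtain c where u: "u \<in> Wsp s p" and c: "c \<noteq> 0" "weak_dipole_solution s p u c x0 y0"
    by blast
  have min: "two_point_minimizer s p x0 y0 u"
    using u weak_dipole_solution_unique_minimizer(1)[OF sp(2) u c(2)]
    by (simp add: two_point_minimizer_def)
  moreover have "u x0 \<noteq> u y0"
  proof
    assume "u x0 = u y0"
    then have "u x = u y" for x y
      by (rule two_point_minimizer_eq_imp_const[OF sp(2) min])
    then have "increment u z = 0" for z
      by (simp add: increment_def)
    then have zero: "gagliardo_form s p u f = 0" for f
      by (simp add: gagliardo_form_def)
    let ?f = "\<lambda>x. max 0 (norm (y0 - x0) - norm (x - x0))"
    have "?f \<in> Wsp s p"
      using sp by (intro hat_in_Wsp) auto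
    then have "gagliardo_form s p u ?f = c * (?f x0 - ?f y0)"
      using c(2) by (simp add: weak_dipole_solution_iff[OF sp(2) u])
    then show False
      using zero[of ?f] c(1) assms by simp
  qed
  ultimately show ?min ..
next
  assume ?min
  then show ?dipole
    using weak_dipole_solution_of_two_point_minimizer[OF sp(2)] two_point_minimizerD(1) by blast
qed

end

theorem theorem7p4:
  fixes s p :: real and x0 y0 :: "'a::euclidean_space" and u :: "'a \<Rightarrow> real"
  assumes "0 < s" "s < 1" "1 < p" "s * p > real DIM('a)" "x0 \<noteq> y0"
  shows "((extremal s p u \<and>
           holder_sn (alpha_sp s p DIM('a)) u
             = \<bar>u x0 - u y0\<bar> / norm (x0 - y0) powr alpha_sp s p DIM('a))
          \<longleftrightarrow> (u \<in> Wsp s p \<and> (\<exists>c. c \<noteq> 0 \<and> weak_dipole_solution s p u c x0 y0)))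
       \<and> ((u \<in> Wsp s p \<and> (\<exists>c. c \<noteq> 0 \<and> weak_dipole_solution s p u c x0 y0))
          \<longleftrightarrow> (u \<in> Wsp s p \<and> (\<exists>x y. u x \<noteq> u y) \<and>
               (\<forall>\<phi>\<in>Wsp s p. \<phi> x0 = u x0 \<and> \<phi> y0 = u y0 \<longrightarrow>
                  gagliardo_p s p u \<le> gagliardo_p s p \<phi> \<and>
                  (gagliardo_p s p \<phi> = gagliardo_p s p u \<longrightarrow> \<phi> = u))))"
    (is "(?extremal \<longleftrightarrow> ?dipole) \<and> (?dipole \<longleftrightarrow> ?unique)")
proof -
  let ?minimizer = "two_point_minimizer s p x0 y0 u \<and> u x0 \<noteq> u y0"
  have "?extremal \<longleftrightarrow> ?minimizer"
    unfolding holder_quot_def[symmetric] by (rule extremal_iff_two_point_minimizer[OF assms(2-4)])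
  moreover have "?dipole \<longleftrightarrow> ?minimizer"
    by (rule dipole_iff_two_point_minimizer[OF assms(2-5)])
  moreover have "?unique \<longleftrightarrow> ?minimizer"
    by (rule unique_two_point_minimizer_iff[OF assms(3)])
  ultimately show ?thesis
    by blast
qed

end
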